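(* Let $V$ be a finite dimensional vector space over a field $\mathbf{k}$ of characteristic zero and let $w\in\Lambda^2(V)$. Then the quantum exterior product $\wedge_h=\wedge_{h,w}$ on $\Lambda_h(V^* )=\Lambda(V^* )[h]$ satisfies $$\alpha\wedge_h\beta=(-1)^{|\alpha||\beta|}\,\beta\wedge_h\alpha\qquad\text{(supercommutativity)},$$ $$(\alpha\wedge_h\beta)\wedge_h\gamma=\alpha\wedge_h(\beta\wedge_h\gamma)\qquad\text{(associativity)}$$ for all $\alpha,\beta,\gamma\in\Lambda_h(V^* )$ (with $\alpha,\beta$ homogeneous in the first identity). Therefore $(\Lambda_h(V^* ),\wedge_h)$ is a deformation quantization of the exterior algebra $(\Lambda(V^* ),\wedge)$.
   Context: For $v\in V$ and $\alpha\in\Lambda^k(V^* )$ put $(v\vdash\alpha)(v_1,\dots,v_{k-1})=\alpha(v,v_1,\dots,v_{k-1})$ and $(\alpha\dashv v)(v_1,\dots,v_{k-1})=\alpha(v_1,\dots,v_{k-1},v)$ (both are $0$ if $k=0$). Let $\{e_1,\dots,e_m\}$ be a basis of $V$ and let $(w^{ij})$ be the skew-symmetric coefficient matrix of $w=w^{ij}e_i\wedge e_j$ (summation over all repeated indices; $w$ is viewed as the skew tensor $w^{ij}e_i\otimes e_j$, so that $w(e^i,e^j)=w^{ij}$ on the dual basis $\{e^i\}$). The quantum exterior product is, for $\alpha,\beta\in\Lambda(V^* )$, $$\alpha\wedge_{h,w}\beta=\sum_{n\ge0}\frac{h^n}{n!}\,w^{i_1j_1}\cdots w^{i_nj_n}\,(\alpha\dashv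 e_{i_1}\dashv\cdots\dashv e_{i_n})\wedge(e_{j_n}\vdash\cdots\vdash e_{j_1}\vdash\beta)\in\Lambda(V^* )[h],$$ where contractions with $e_{i_1}$, resp. $e_{j_1}$, are performed first; it is independent of the basis and is extended $\mathbf{k}[h]$-bilinearly to $\Lambda_h(V^* )=\Lambda(V^* )\otimes_{\mathbf{k}}\mathbf{k}[h]$. The grading on $\Lambda_h(V^* )$ is the usual one on $\Lambda(V^* )$ with $h$ of degree $2$; $|\alpha|$ denotes the degree of a homogeneous element. "Deformation quantization of $(\Lambda(V^* ),\wedge)$" means an associative $\mathbf{k}[h]$-bilinear product on $\Lambda(V^* )[h]$ which reduces to $\wedge$ modulo $h$. *)

theory Defs
  imports Complex_Main
    "HOL-Library.Function_Algebras"
    "HOL-Library.Groups_Big_Fun"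
    "HOL-Computational_Algebra.Polynomial"
begin

text \<open>
  A form on \<open>V\<close> is a function on finite lists of vectors; its restriction to lists of
  length \<open>k\<close> is its component of degree \<open>k\<close>.  Addition and zero of forms are the pointwise ones.
\<close>

type_synonym ('v, 'k) form = "'v list \<Rightarrow> 'k"

definition ext_pow ::
    "('k::field_char_0 \<Rightarrow> 'v::ab_group_add \<Rightarrow> 'v) \<Rightarrow> nat \<Rightarrow> ('v, 'k) form set" where
  "ext_pow scale k = {\<alpha>.
     (\<forall>us vs. length us + 1 + length vs = k \<longrightarrow>
        Vector_Spaces.linear scale (*) (\<lambda>v. \<alpha> (us @ v # vs))) \<and>
     (\<forall>us v vs ws. \<alpha> (us @ v # vs @ v # ws) = 0) \<and>
     (\<forall>vs. length vs \<noteq> k \<longrightarrow> \<alpha> vs = 0)}"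

definition component :: "nat \<Rightarrow> ('v, 'k::zero) form \<Rightarrow> ('v, 'k) form" where
  "component k \<alpha> = (\<lambda>vs. if length vs = k then \<alpha> vs else 0)"

definition ext_alg ::
    "('k::field_char_0 \<Rightarrow> 'v::ab_group_add \<Rightarrow> 'v) \<Rightarrow> ('v, 'k) form set" where
  "ext_alg scale =
     {\<alpha>. (\<forall>k. component k \<alpha> \<in> ext_pow scale k) \<and> finite {k. component k \<alpha> \<noteq> 0}}"

text \<open>
  The exterior product in the normalization for which contractions are (graded) derivations:
  \<open>(\<alpha> \<and> \<beta>)(v\<^sub>1,\<dots>,v\<^sub>k\<^sub>+\<^sub>l) = \<Sum>\<^sub>\<sigma> sgn(\<sigma>) \<alpha>(v\<^sub>\<sigma>\<^sub>(\<^sub>1\<^sub>),\<dots>,v\<^sub>\<sigma>\<^sub>(\<^sub>k\<^sub>)) \<beta>(v\<^sub>\<sigma>\<^sub>(\<^sub>k\<^sub>+\<^sub>1\<^sub>),\<dots>,v\<^sub>\<sigma>\<^sub>(\<^sub>k\<^sub>+\<^sub>l\<^sub>))\<close> over all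
  \<open>(k,l)\<close>-shuffles \<open>\<sigma>\<close>, that is, \<open>1/(k! l!)\<close> times the sum over all permutations.
  A shuffle is given by the set \<open>S\<close> of the (0-based) positions whose vectors are fed to \<open>\<alpha>\<close>;
  its sign is determined by the number of its inversions.
\<close>

definition shuffle_sign :: "nat \<Rightarrow> nat set \<Rightarrow> 'k::ring_1" where
  "shuffle_sign n S = (-1) ^ card {(i, j). i \<in> S \<and> j \<in> {..<n} - S \<and> j < i}"

definition wedge :: "('v, 'k::comm_ring_1) form \<Rightarrow> ('v, 'k) form \<Rightarrow> ('v, 'k) form" where
  "wedge \<alpha> \<beta> = (\<lambda>vs. \<Sum>S\<in>Pow {..<length vs}.
     shuffle_sign (length vs) S * \<alpha> (nths vs S) * \<beta> (nths vs ({..<length vs} - S)))"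

definition lcontr :: "'v \<Rightarrow> ('v, 'k) form \<Rightarrow> ('v, 'k) form" (infixr "\<turnstile>" 75) where
  "v \<turnstile> \<alpha> = (\<lambda>vs. \<alpha> (v # vs))"

definition rcontr :: "('v, 'k) form \<Rightarrow> 'v \<Rightarrow> ('v, 'k) form" (infixl "\<stileturn>" 75) where
  "\<alpha> \<stileturn> v = (\<lambda>vs. \<alpha> (vs @ [v]))"

definition dual_space :: "('k::field \<Rightarrow> 'v::ab_group_add \<Rightarrow> 'v) \<Rightarrow> ('v \<Rightarrow> 'k) set" where
  "dual_space scale = {\<phi>. Vector_Spaces.linear scale (*) \<phi>}"

text \<open>
  For finite-dimensional \<open>V\<close>, elements of \<open>\<Lambda>\<^sup>2(V)\<close>, viewed as skew tensors in \<open>V \<otimes> V\<close>, are the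
  skew-symmetric bilinear forms on the dual space.
\<close>

definition bivector ::
    "('k::field \<Rightarrow> 'v::ab_group_add \<Rightarrow> 'v) \<Rightarrow> (('v \<Rightarrow> 'k) \<Rightarrow> ('v \<Rightarrow> 'k) \<Rightarrow> 'k) \<Rightarrow> bool" where
  "bivector scale w \<longleftrightarrow>
     (\<forall>\<phi>\<in>dual_space scale. \<forall>\<psi>\<in>dual_space scale. \<forall>\<chi>\<in>dual_space scale. \<forall>a b.
        w (\<lambda>v. a * \<phi> v + b * \<psi> v) \<chi> = a * w \<phi> \<chi> + b * w \<psi> \<chi> \<and>
        w \<chi> (\<lambda>v. a * \<phi> v + b * \<psi> v) = a * w \<chi> \<phi> + b * w \<chi> \<psi>) \<and>
     (\<forall>\<phi>\<in>dual_space scale. \<forall>\<psi>\<in>dual_space scale. w \<phi> \<psi> = - w \<psi> \<phi>)"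

definition dual_basis ::
    "('k::field \<Rightarrow> 'v::ab_group_add \<Rightarrow> 'v) \<Rightarrow> 'v set \<Rightarrow> 'v \<Rightarrow> ('v \<Rightarrow> 'k)" where
  "dual_basis scale B e = (\<lambda>v. module.representation scale B v e)"

text \<open>
  The multi-indices \<open>i\<^sub>1,\<dots>,i\<^sub>n\<close> and \<open>j\<^sub>1,\<dots>,j\<^sub>n\<close> are lists \<open>es\<close> and \<open>fs\<close> of vectors of the
  basis \<open>B\<close>; both folds contract with the head of the list first.
\<close>

definition qwedge_term ::
    "('k::field_char_0 \<Rightarrow> 'v::ab_group_add \<Rightarrow> 'v) \<Rightarrow> 'v set \<Rightarrow>
     (('v \<Rightarrow> 'k) \<Rightarrow> ('v \<Rightarrow> 'k) \<Rightarrow> 'k) \<Rightarrow> nat \<Rightarrow>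
     ('v, 'k) form \<Rightarrow> ('v, 'k) form \<Rightarrow> ('v, 'k) form" where
  "qwedge_term scale B w n \<alpha> \<beta> = (\<lambda>vs. 1 / fact n *
     (\<Sum>es\<in>{es. set es \<subseteq> B \<and> length es = n}. \<Sum>fs\<in>{fs. set fs \<subseteq> B \<and> length fs = n}.
        (\<Prod>s<n. w (dual_basis scale B (es ! s)) (dual_basis scale B (fs ! s))) *
        wedge (foldl (\<stileturn>) \<alpha> es) (fold (\<turnstile>) fs \<beta>) vs))"

text \<open>
  \<open>\<Lambda>\<^sub>h(V\<^sup>*)\<close> consists of the polynomials in \<open>h\<close> with coefficients in \<open>\<Lambda>(V\<^sup>*)\<close>.  On elements
  of \<open>\<Lambda>(V\<^sup>*)\<close> only finitely many terms of the sum below are nonzero.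
\<close>

definition qwedge ::
    "('k::field_char_0 \<Rightarrow> 'v::ab_group_add \<Rightarrow> 'v) \<Rightarrow> 'v set \<Rightarrow>
     (('v \<Rightarrow> 'k) \<Rightarrow> ('v \<Rightarrow> 'k) \<Rightarrow> 'k) \<Rightarrow>
     ('v, 'k) form \<Rightarrow> ('v, 'k) form \<Rightarrow> ('v, 'k) form poly" where
  "qwedge scale B w \<alpha> \<beta> = Sum_any (\<lambda>n. monom (qwedge_term scale B w n \<alpha> \<beta>) n)"

definition ext_alg_h ::
    "('k::field_char_0 \<Rightarrow> 'v::ab_group_add \<Rightarrow> 'v) \<Rightarrow> ('v, 'k) form poly set" where
  "ext_alg_h scale = {A. \<forall>n. coeff A n \<in> ext_alg scale}"

text \<open>
  The action of \<open>k[h]\<close>: scalars become constant functions, which act on forms by pointwise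
  multiplication (this is the only use made of the pointwise product of forms).
\<close>

definition scale_h :: "'k::field_char_0 poly \<Rightarrow> ('v, 'k) form poly \<Rightarrow> ('v, 'k) form poly" where
  "scale_h p A = map_poly (\<lambda>c _. c) p * A"

definition qwedge_h ::
    "('k::field_char_0 \<Rightarrow> 'v::ab_group_add \<Rightarrow> 'v) \<Rightarrow> 'v set \<Rightarrow>
     (('v \<Rightarrow> 'k) \<Rightarrow> ('v \<Rightarrow> 'k) \<Rightarrow> 'k) \<Rightarrow>
     ('v, 'k) form poly \<Rightarrow> ('v, 'k) form poly \<Rightarrow> ('v, 'k) form poly" where
  "qwedge_h scale B w A C =
     (\<Sum>i\<le>degree A. \<Sum>j\<le>degree C.
        scale_h (monom 1 (i + j)) (qwedge scale B w (coeff A i) (coeff C j)))"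

text \<open>Homogeneous elements of degree \<open>d\<close>, where \<open>h\<close> has degree 2; zero has every degree.\<close>

definition homogeneous_h ::
    "('k::field_char_0 \<Rightarrow> 'v::ab_group_add \<Rightarrow> 'v) \<Rightarrow> nat \<Rightarrow> ('v, 'k) form poly set" where
  "homogeneous_h scale d =
     {A \<in> ext_alg_h scale. \<forall>n k. component k (coeff A n) \<noteq> 0 \<longrightarrow> k + 2 * n = d}"

definition deformation_quantization ::
    "('k::field_char_0 \<Rightarrow> 'v::ab_group_add \<Rightarrow> 'v) \<Rightarrow>
     (('v, 'k) form poly \<Rightarrow> ('v, 'k) form poly \<Rightarrow> ('v, 'k) form poly) \<Rightarrow> bool" where
  "deformation_quantization scale m \<longleftrightarrow>
     (\<forall>A\<in>ext_alg_h scale. \<forall>B\<in>ext_alg_h scale. m A B \<in> ext_alg_h scale) \<and>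
     (\<forall>A\<in>ext_alg_h scale. \<forall>B\<in>ext_alg_h scale. \<forall>C\<in>ext_alg_h scale. \<forall>p q.
        m (scale_h p A + scale_h q B) C = scale_h p (m A C) + scale_h q (m B C) \<and>
        m C (scale_h p A + scale_h q B) = scale_h p (m C A) + scale_h q (m C B)) \<and>
     (\<forall>A\<in>ext_alg_h scale. \<forall>B\<in>ext_alg_h scale. \<forall>C\<in>ext_alg_h scale.
        m (m A B) C = m A (m B C)) \<and>
     (\<forall>A\<in>ext_alg_h scale. \<forall>B\<in>ext_alg_h scale.
        coeff (m A B) 0 = wedge (coeff A 0) (coeff B 0))"

end

theory Submission
  imports Defs
begin

text \<open>
  Left and right contractions are graded derivations of the exterior product, and since they
  anticommute with each other on alternating forms, also of the quantum product.  The quantum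
  product satisfies the differential equation
  \<open>d/dh (\<alpha> \<and>\<^sub>h \<beta>) = \<Sum>\<^sub>i\<^sub>j w\<^sup>i\<^sup>j (\<alpha> \<stileturn> e\<^sub>i) \<and>\<^sub>h (e\<^sub>j \<turnstile> \<beta>)\<close>.  Differentiating
  \<open>(\<alpha> \<and>\<^sub>h \<beta>) \<and>\<^sub>h \<gamma>\<close> and \<open>\<alpha> \<and>\<^sub>h (\<beta> \<and>\<^sub>h \<gamma>)\<close> in \<open>h\<close> and applying the derivation rules gives the same sum
  of triple products of contracted forms, so associativity follows by induction on the power of
  \<open>h\<close> from associativity of the exterior product.  Supercommutativity is obtained in the same way,
  using the skew symmetry of \<open>w\<close>.
\<close>

section \<open>Forms as a vector space, the grading involution and contractions\<close>

definition form_scale :: "'k::field_char_0 \<Rightarrow> ('v, 'k) form \<Rightarrow> ('v, 'k) form" (infixr "*\<^sub>f" 75)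
  where "c *\<^sub>f \<alpha> = (\<lambda>vs. c * \<alpha> vs)"

lemma form_scale_apply [simp]: "(c *\<^sub>f \<alpha>) vs = c * \<alpha> vs"
  by (simp add: form_scale_def)

text \<open>Makes the \<open>module_hom\<close> rules available: once an operation is shown to be
  \<open>form_linear\<close>, its rules for sums, negation, scalars and zero follow.\<close>

interpretation form: vector_space "form_scale :: 'k::field_char_0 \<Rightarrow> ('v, 'k) form \<Rightarrow> ('v, 'k) form"
  by unfold_locales (auto simp: form_scale_def fun_eq_iff algebra_simps)

abbreviation form_linear :: "(('v, 'k::field_char_0) form \<Rightarrow> ('v, 'k) form) \<Rightarrow> bool"
  where "form_linear \<equiv> module_hom form_scale form_scale"

lemma form_linearI:
  assumes "\<And>\<alpha> \<beta>. F (\<alpha> + \<beta>) = F \<alpha> + F \<beta>" "\<And>c \<alpha>. F (c *\<^sub>f \<alpha>) = c *\<^sub>f F \<alpha>"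
  shows "form_linear F"
  using assms by (auto simp: module_hom_def module_hom_axioms_def form.module_axioms)

lemma sum_form_apply: "(\<Sum>x\<in>A. g x) vs = (\<Sum>x\<in>A. g x vs)" for g :: "'a \<Rightarrow> ('v, 'k::comm_ring_1) form"
  by (induction A rule: infinite_finite_induct) auto

text \<open>The grading involution. Carrying the sign of the graded Leibniz rule as an operator lets
  that rule be stated for inhomogeneous forms.\<close>

definition parity :: "('v, 'k::field_char_0) form \<Rightarrow> ('v, 'k) form"
  where "parity \<alpha> = (\<lambda>vs. (-1) ^ length vs * \<alpha> vs)"

lemma form_linear_lcontr: "form_linear ((\<turnstile>) v)"
  by (rule form_linearI) (auto simp: lcontr_def fun_eq_iff)

lemma form_linear_rcontr: "form_linear (\<lambda>\<alpha>. \<alpha> \<stileturn> v)"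
  by (rule form_linearI) (auto simp: rcontr_def fun_eq_iff)

lemma parity_parity [simp]: "parity (parity \<alpha>) = \<alpha>"
  by (auto simp: parity_def fun_eq_iff simp flip: power_add mult.assoc)

lemma parity_lcontr: "parity (v \<turnstile> \<alpha>) = - (v \<turnstile> parity \<alpha>)"
  by (auto simp: parity_def lcontr_def fun_eq_iff)

lemma parity_rcontr: "parity (\<alpha> \<stileturn> v) = - (parity \<alpha> \<stileturn> v)"
  by (auto simp: parity_def rcontr_def fun_eq_iff)

text \<open>The two contractions act on opposite ends of the argument list. Hence signs in the
  derivation rules below come only from \<open>parity\<close> and from exchanging two contractions
  on the same side.\<close>

lemma lcontr_rcontr: "(u \<turnstile> \<alpha>) \<stileturn> v = u \<turnstile> (\<alpha> \<stileturn> v)"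
  by (auto simp: lcontr_def rcontr_def)

section \<open>The exterior product\<close>

text \<open>Position 0 precedes all others: if selected it causes no inversion, and if not, it is
  inverted with each of the \<open>card T\<close> selected positions.\<close>

lemma shuffle_sign_Suc:
  assumes "T \<subseteq> {..<n}"
  shows "shuffle_sign (Suc n) (insert 0 (Suc ` T)) = (shuffle_sign n T :: 'k::comm_ring_1)"
    and "shuffle_sign (Suc n) (Suc ` T) = (-1) ^ card T * (shuffle_sign n T :: 'k::comm_ring_1)"
proof -
  define I where "I = {(i, j). i \<in> T \<and> j \<in> {..<n} - T \<and> j < i}"
  have fT: "finite T" using assms finite_subset by blast
  have fI: "finite I" by (rule finite_subset[of _ "T \<times> {..<n}"]) (use fT in \<open>auto simp: I_def\<close>)
  have inj: "inj_on (map_prod Suc Suc) I" by (auto simp: inj_on_def)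
  have 1: "{(i, j). i \<in> insert 0 (Suc ` T) \<and> j \<in> {..<Suc n} - insert 0 (Suc ` T) \<and> j < i}
      = map_prod Suc Suc ` I" (is "?L = ?R")
  proof (intro equalityI subsetI)
    fix x assume "x \<in> ?L"
    then obtain i j where x: "x = (i, j)" "i \<in> insert 0 (Suc ` T)" "j < Suc n"
      "j \<notin> insert 0 (Suc ` T)" "j < i" by auto
    then obtain j' where "j = Suc j'" by (cases j) auto
    then show "x \<in> ?R" using x by (auto simp: I_def image_iff)
  qed (auto simp: I_def)
  have 2: "{(i, j). i \<in> Suc ` T \<and> j \<in> {..<Suc n} - Suc ` T \<and> j < i}
      = map_prod Suc Suc ` I \<union> Suc ` T \<times> {0}" (is "?L = ?R")
  proof (intro equalityI subsetI)
    fix x assume "x \<in> ?L"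
    then obtain i j where x: "x = (i, j)" "i \<in> Suc ` T" "j < Suc n"
      "j \<notin> Suc ` T" "j < i" by auto
    show "x \<in> ?R" using x by (cases j) (auto simp: I_def image_iff)
  qed (auto simp: I_def)
  have "card (map_prod Suc Suc ` I \<union> Suc ` T \<times> {0}) = card I + card T"
    using fI fT by (subst card_Un_disjoint) (auto simp: card_image[OF inj] card_image)
  then show "shuffle_sign (Suc n) (Suc ` T) = (-1) ^ card T * (shuffle_sign n T :: 'k)"
    unfolding shuffle_sign_def 2 I_def[symmetric] by (simp only: power_add mult.commute)
  show "shuffle_sign (Suc n) (insert 0 (Suc ` T)) = (shuffle_sign n T :: 'k)"
    unfolding shuffle_sign_def 1 I_def[symmetric] by (simp add: card_image[OF inj])
qed

text \<open>Splitting subsets by membership of 0 matches the choice of the factor that receives the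
  first vector.\<close>

lemma sum_Pow_lessThan_Suc:
  fixes g :: "nat set \<Rightarrow> 'a::comm_monoid_add"
  shows "sum g (Pow {..<Suc n}) =
    (\<Sum>T\<in>Pow {..<n}. g (insert 0 (Suc ` T))) + (\<Sum>T\<in>Pow {..<n}. g (Suc ` T))"
proof -
  have inj: "inj_on ((`) Suc) (Pow {..<n})" by (auto simp: inj_on_def dest: inj_image_eq_iff[THEN iffD1, rotated])
  have disj: "insert 0 ` ((`) Suc ` Pow {..<n}) \<inter> (`) Suc ` Pow {..<n} = {}" by auto
  have inj2: "inj_on (insert 0) ((`) Suc ` Pow {..<n})"
    by (rule inj_onI) (metis (no_types, lifting) Diff_insert_absorb image_iff nat.discI)
  have "sum g (Pow {..<Suc n}) = sum g (insert 0 ` ((`) Suc ` Pow {..<n})) + sum g ((`) Suc ` Pow {..<n})"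
    unfolding lessThan_Suc_eq_insert_0 Pow_insert image_Pow_surj[OF refl, symmetric]
    by (subst Un_commute, rule sum.union_disjoint) (use disj in auto)
  also have "\<dots> = (\<Sum>T\<in>Pow {..<n}. g (insert 0 (Suc ` T))) + (\<Sum>T\<in>Pow {..<n}. g (Suc ` T))"
    by (simp add: sum.reindex[OF inj] sum.reindex[OF inj2] o_def)
  finally show ?thesis .
qed

lemma wedge_Nil: "wedge \<alpha> \<beta> [] = \<alpha> [] * \<beta> []"
  by (simp add: wedge_def shuffle_sign_def)

text \<open>The first vector goes to \<alpha> or to \<beta>; in the latter case it passes the
  \<open>card T\<close> arguments of \<alpha>, whence \<open>parity\<close>. With
  \<open>wedge_Nil\<close> this acts as a recursive description of \<open>wedge\<close>, so later
  proofs induct on the list of vectors instead of handling shuffles.\<close>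

lemma wedge_Cons: "wedge \<alpha> \<beta> (v # vs) = wedge (v \<turnstile> \<alpha>) \<beta> vs + wedge (parity \<alpha>) (v \<turnstile> \<beta>) vs"
proof -
  let ?n = "length vs"
  have "{j. Suc j \<in> insert 0 (Suc ` T)} = T" "{j. Suc j \<in> Suc ` T} = T"
    "{j. Suc j \<in> {..<Suc ?n} - insert 0 (Suc ` T)} = {..<?n} - T"
    "{j. Suc j \<in> {..<Suc ?n} - Suc ` T} = {..<?n} - T" for T by auto
  then have n: "nths (v # vs) (insert 0 (Suc ` T)) = v # nths vs T"
    "nths (v # vs) (Suc ` T) = nths vs T"
    "nths (v # vs) ({..<Suc ?n} - insert 0 (Suc ` T)) = nths vs ({..<?n} - T)"
    "nths (v # vs) ({..<Suc ?n} - Suc ` T) = v # nths vs ({..<?n} - T)" for T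
    by (simp_all only: nths_Cons) auto
  have len: "length (nths vs T) = card T" if "T \<subseteq> {..<?n}" for T
  proof -
    have "{i. i < ?n \<and> i \<in> T} = T" using that by auto
    then show ?thesis by (simp add: length_nths)
  qed
  show ?thesis
    unfolding wedge_def length_Cons sum_Pow_lessThan_Suc n
    by (intro arg_cong2[where f = "(+)"] sum.cong refl)
       (auto simp: lcontr_def parity_def shuffle_sign_Suc len)
qed

lemma lcontr_wedge: "v \<turnstile> wedge \<alpha> \<beta> = wedge (v \<turnstile> \<alpha>) \<beta> + wedge (parity \<alpha>) (v \<turnstile> \<beta>)"
  by (rule ext) (simp add: lcontr_def[of v "wedge \<alpha> \<beta>"] wedge_Cons)

lemma form_linear_wedge1: "form_linear (\<lambda>\<alpha>. wedge \<alpha> \<beta>)"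
  by (rule form_linearI)
     (auto simp: wedge_def fun_eq_iff algebra_simps sum.distrib sum_distrib_left)

lemma form_linear_wedge2: "form_linear (wedge \<alpha>)"
  by (rule form_linearI)
     (auto simp: wedge_def fun_eq_iff algebra_simps sum.distrib sum_distrib_left)

lemmas lcontr_simps = module_hom.add[OF form_linear_lcontr] module_hom.neg[OF form_linear_lcontr]
  module_hom.scale[OF form_linear_lcontr] module_hom.sum[OF form_linear_lcontr]

lemmas rcontr_simps = module_hom.add[OF form_linear_rcontr] module_hom.neg[OF form_linear_rcontr]
  module_hom.scale[OF form_linear_rcontr] module_hom.sum[OF form_linear_rcontr]

lemmas wedge_simps = module_hom.add[OF form_linear_wedge1] module_hom.neg[OF form_linear_wedge1]
  module_hom.scale[OF form_linear_wedge1] module_hom.zero[OF form_linear_wedge1]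
  module_hom.add[OF form_linear_wedge2] module_hom.neg[OF form_linear_wedge2]
  module_hom.scale[OF form_linear_wedge2] module_hom.zero[OF form_linear_wedge2]

text \<open>Degrees add under \<open>wedge\<close>, so the involution is multiplicative.
  Associativity uses this to distribute the \<open>parity\<close> that falls on a product.\<close>

lemma wedge_parity: "wedge (parity \<alpha>) (parity \<beta>) = parity (wedge \<alpha> \<beta>)"
proof
  fix vs show "wedge (parity \<alpha>) (parity \<beta>) vs = parity (wedge \<alpha> \<beta>) vs"
  proof (induction vs arbitrary: \<alpha> \<beta>)
    case Nil
    then show ?case by (simp add: wedge_Nil parity_def)
  next
    case (Cons v vs)
    \<comment> \<open>\<open>parity_lcontr\<close> turned around: \<open>parity\<close> has to be
      outermost on each factor for the induction hypothesis to apply.\<close>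
    have l: "v \<turnstile> parity \<gamma> = - parity (v \<turnstile> \<gamma>)" for \<gamma> :: "('a, 'b) form" by (simp add: parity_lcontr)
    show ?case
      using Cons.IH[of "v \<turnstile> \<alpha>" \<beta>] Cons.IH[of "parity \<alpha>" "v \<turnstile> \<beta>"]
      by (simp add: wedge_Cons l wedge_simps) (simp add: parity_def wedge_Cons algebra_simps)
  qed
qed

text \<open>To reach \<alpha> from the right, a vector passes all arguments of \<beta>, so here the
  involution falls on \<beta>. The induction still peels vectors off the front, as
  \<open>wedge_Cons\<close> requires.\<close>

lemma rcontr_wedge: "wedge \<alpha> \<beta> \<stileturn> v = wedge \<alpha> (\<beta> \<stileturn> v) + wedge (\<alpha> \<stileturn> v) (parity \<beta>)"
proof
  fix vs show "(wedge \<alpha> \<beta> \<stileturn> v) vs = (wedge \<alpha> (\<beta> \<stileturn> v) + wedge (\<alpha> \<stileturn> v) (parity \<beta>)) vs"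
  proof (induction vs arbitrary: \<alpha> \<beta>)
    case Nil
    then show ?case by (simp add: rcontr_def wedge_Cons wedge_Nil lcontr_def parity_def)
  next
    case (Cons u vs)
    have "(wedge \<alpha> \<beta> \<stileturn> v) (u # vs) = (wedge (u \<turnstile> \<alpha>) \<beta> \<stileturn> v) vs + (wedge (parity \<alpha>) (u \<turnstile> \<beta>) \<stileturn> v) vs"
      by (simp add: rcontr_def wedge_Cons)
    also have "\<dots> = (wedge \<alpha> (\<beta> \<stileturn> v) + wedge (\<alpha> \<stileturn> v) (parity \<beta>)) (u # vs)"
      by (simp add: Cons.IH wedge_Cons parity_lcontr parity_rcontr wedge_simps lcontr_rcontr
          wedge_simps(6)[unfolded fun_Compl_def])
    finally show ?case .
  qed
qed

text \<open>Both bracketings expand into the same three terms, according to which of the three forms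
  receives the first vector.\<close>

lemma wedge_assoc: "wedge (wedge \<alpha> \<beta>) \<gamma> = wedge \<alpha> (wedge \<beta> \<gamma>)"
  for \<alpha> :: "('v, 'k::field_char_0) form"
proof
  fix vs show "wedge (wedge \<alpha> \<beta>) \<gamma> vs = wedge \<alpha> (wedge \<beta> \<gamma>) vs"
  proof (induction vs arbitrary: \<alpha> \<beta> \<gamma>)
    case Nil
    then show ?case by (simp add: wedge_Nil)
  next
    case (Cons v vs)
    then show ?case by (simp add: wedge_Cons lcontr_wedge wedge_simps flip: wedge_parity)
  qed
qed

section \<open>Degree, graded commutativity and alternating forms\<close>

definition of_degree :: "nat \<Rightarrow> ('v, 'k::zero) form \<Rightarrow> bool"
  where "of_degree p \<alpha> \<longleftrightarrow> (\<forall>vs. length vs \<noteq> p \<longrightarrow> \<alpha> vs = 0)"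

text \<open>Subtraction is truncated, so for \<open>p = 0\<close> the first two claims do not lower
  the degree; the last two cover that case, which later proofs split off.\<close>

lemma of_degree_contr:
  assumes "of_degree p \<alpha>"
  shows "of_degree (p - 1) (v \<turnstile> \<alpha>)" "of_degree (p - 1) (\<alpha> \<stileturn> v)"
    "p = 0 \<Longrightarrow> v \<turnstile> \<alpha> = 0" "p = 0 \<Longrightarrow> \<alpha> \<stileturn> v = 0"
  using assms by (auto simp: of_degree_def lcontr_def rcontr_def fun_eq_iff)

lemma parity_of_degree: "of_degree p \<alpha> \<Longrightarrow> parity \<alpha> = (-1) ^ p *\<^sub>f \<alpha>"
  by (fastforce simp: of_degree_def parity_def fun_eq_iff)

text \<open>Expanding both sides by \<open>wedge_Cons\<close>, the term in which \<alpha> takes the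
  first vector is the first on one side and the second on the other.\<close>

lemma wedge_commute:
  assumes "of_degree p \<alpha>" "of_degree q \<beta>"
  shows "wedge \<alpha> \<beta> = (-1) ^ (p * q) *\<^sub>f wedge \<beta> \<alpha>"
proof
  fix vs show "wedge \<alpha> \<beta> vs = ((-1) ^ (p * q) *\<^sub>f wedge \<beta> \<alpha>) vs"
    using assms
  proof (induction vs arbitrary: \<alpha> \<beta> p q)
    case Nil
    then show ?case by (cases "p = 0 \<and> q = 0") (auto simp: wedge_Nil of_degree_def)
  next
    case (Cons v vs)
    note d = of_degree_contr[OF Cons.prems(1)] of_degree_contr[OF Cons.prems(2)]
    \<comment> \<open>The exponent \<open>(p - 1) * q\<close> of the induction hypothesis agrees
      with \<open>p * q + q\<close> modulo 2. The extra \<open>(-1) ^ q\<close> is what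
      \<open>parity\<close> of \<beta> contributes on the other side.\<close>
    have 1: "wedge (v \<turnstile> \<alpha>) \<beta> vs = (-1) ^ (p * q) * (-1) ^ q * wedge \<beta> (v \<turnstile> \<alpha>) vs"
    proof (cases p)
      case 0
      then show ?thesis by (simp add: d wedge_simps)
    next
      case (Suc p')
      then show ?thesis using Cons.IH[OF d(1) Cons.prems(2)]
        by (simp add: power_add flip: power_mult_distrib mult.assoc)
    qed
    have 2: "(-1) ^ p * wedge \<alpha> (v \<turnstile> \<beta>) vs = (-1) ^ (p * q) * wedge (v \<turnstile> \<beta>) \<alpha> vs"
    proof (cases q)
      case 0
      then show ?thesis by (simp add: d wedge_simps)
    next
      case (Suc q')
      then show ?thesis using Cons.IH[OF Cons.prems(1) d(5)]
        by (simp add: power_add flip: power_mult_distrib mult.assoc)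
    qed
    show ?case using 1 2
      by (simp add: wedge_Cons parity_of_degree[OF Cons.prems(1)] parity_of_degree[OF Cons.prems(2)]
          wedge_simps algebra_simps)
  qed
qed


text \<open>The sign rule for neighbours is used in place of vanishing on repeated vectors because
  it passes to contractions and products without appeal to linearity. \<open>ext_alg_iff\<close>
  relates the two.\<close>

definition alternating :: "('v, 'k::ring_1) form \<Rightarrow> bool"
  where "alternating \<alpha> \<longleftrightarrow> (\<forall>us u v vs. \<alpha> (us @ u # v # vs) = - \<alpha> (us @ v # u # vs))"

lemma alternatingD: "alternating \<alpha> \<Longrightarrow> \<alpha> (us @ u # v # vs) = - \<alpha> (us @ v # u # vs)"
  unfolding alternating_def by blast

lemma alternating_parity:
  assumes "alternating \<alpha>" shows "alternating (parity \<alpha>)"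
  unfolding alternating_def parity_def
proof (intro allI)
  fix us u v vs
  show "(-1) ^ length (us @ u # v # vs) * \<alpha> (us @ u # v # vs) =
      - ((-1) ^ length (us @ v # u # vs) * \<alpha> (us @ v # u # vs))"
    unfolding alternatingD[OF assms, of us u v vs] by simp
qed

lemma alternating_lcontr:
  assumes "alternating \<alpha>" shows "alternating (v \<turnstile> \<alpha>)"
  unfolding alternating_def lcontr_def append_Cons[symmetric]
  by (intro allI alternatingD[OF assms])

lemma alternating_rcontr:
  assumes "alternating \<alpha>" shows "alternating (\<alpha> \<stileturn> v)"
  unfolding alternating_def rcontr_def append.assoc append_Cons
  by (intro allI alternatingD[OF assms])

lemma lcontr_lcontr: "alternating \<alpha> \<Longrightarrow> u \<turnstile> v \<turnstile> \<alpha> = - (v \<turnstile> u \<turnstile> \<alpha>)"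
  unfolding lcontr_def fun_Compl_def by (rule ext, drule alternatingD[of _ "[]"], simp)

lemma rcontr_rcontr: "alternating \<alpha> \<Longrightarrow> \<alpha> \<stileturn> u \<stileturn> v = - (\<alpha> \<stileturn> v \<stileturn> u)"
  unfolding rcontr_def fun_Compl_def append.assoc append_Cons append_Nil
  by (rule ext) (rule alternatingD)

lemma alternating_move:
  assumes "alternating \<alpha>"
  shows "\<alpha> (us @ vs @ v # ws) = (-1) ^ length vs * \<alpha> (us @ v # vs @ ws)"
proof (induction vs arbitrary: us)
  case (Cons u vs)
  show ?case using Cons[of "us @ [u]"] alternatingD[OF assms, of us u v "vs @ ws"] by simp
qed simp

text \<open>The last argument moves to the front past the \<open>p - 1\<close> others. For
  \<open>p = 0\<close> both sides vanish.\<close>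

lemma rcontr_eq_lcontr:
  assumes "alternating \<alpha>" "of_degree p \<alpha>"
  shows "\<alpha> \<stileturn> v = (-1) ^ (p - 1) *\<^sub>f (v \<turnstile> \<alpha>)"
proof
  fix vs
  show "(\<alpha> \<stileturn> v) vs = ((-1) ^ (p - 1) *\<^sub>f (v \<turnstile> \<alpha>)) vs"
    using alternating_move[OF assms(1), of "[]" vs v "[]"] assms(2)
    by (cases "Suc (length vs) = p") (auto simp: rcontr_def lcontr_def of_degree_def)
qed

section \<open>The quantum exterior product\<close>

lemmas form_apply = plus_fun_apply zero_fun_apply uminus_apply minus_apply form_scale_apply

text \<open>
  Resolution may eta-expand terms of function type; pointwise simplification rules would then
  unfold the algebraic operations on forms.
\<close>

declare form_apply [simp del]

lemma sum_lists_Suc: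
  assumes "finite B"
  shows "sum g {xs. set xs \<subseteq> B \<and> length xs = Suc n} =
    (\<Sum>x\<in>B. \<Sum>xs\<in>{xs. set xs \<subseteq> B \<and> length xs = n}. g (x # xs))"
proof -
  have "{xs. set xs \<subseteq> B \<and> length xs = Suc n} =
      (\<lambda>(x, xs). x # xs) ` (B \<times> {xs. set xs \<subseteq> B \<and> length xs = n})"
    by (auto simp: length_Suc_conv image_iff)
  moreover have "inj_on (\<lambda>(x, xs). x # xs) (B \<times> {xs. set xs \<subseteq> B \<and> length xs = n})"
    by (auto simp: inj_on_def)
  ultimately show ?thesis
    by (simp only: sum.reindex sum.cartesian_product) (simp add: case_prod_beta)
qed

text \<open>The product rule for \<open>d/dh\<close> at the coefficient of \<open>h^N\<close>: the
  factor \<open>Suc N\<close> is split as \<open>a + b\<close> over the pairs with that sum, and the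
  terms with weight 0 are dropped.\<close>

lemma sum_weighted_antidiagonal:
  fixes G :: "nat \<Rightarrow> nat \<Rightarrow> ('v, 'k::field_char_0) form"
  shows "of_nat (Suc N) *\<^sub>f (\<Sum>a\<le>Suc N. G a (Suc N - a)) =
    (\<Sum>a\<le>N. of_nat (Suc a) *\<^sub>f G (Suc a) (N - a)) +
    (\<Sum>a\<le>N. of_nat (Suc (N - a)) *\<^sub>f G a (Suc (N - a)))"
proof -
  have "of_nat (Suc N) *\<^sub>f (\<Sum>a\<le>Suc N. G a (Suc N - a)) =
      (\<Sum>a\<le>Suc N. of_nat a *\<^sub>f G a (Suc N - a)) + (\<Sum>a\<le>Suc N. of_nat (Suc N - a) *\<^sub>f G a (Suc N - a))"
    unfolding form.scale_sum_right sum.distrib[symmetric] form.scale_left_distrib[symmetric]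
    by (intro sum.cong refl) (simp add: of_nat_diff)
  also have "(\<Sum>a\<le>Suc N. of_nat a *\<^sub>f G a (Suc N - a)) = (\<Sum>a\<le>N. of_nat (Suc a) *\<^sub>f G (Suc a) (N - a))"
    by (subst sum.atMost_Suc_shift) simp
  also have "(\<Sum>a\<le>Suc N. of_nat (Suc N - a) *\<^sub>f G a (Suc N - a)) =
      (\<Sum>a\<le>N. of_nat (Suc (N - a)) *\<^sub>f G a (Suc (N - a)))"
    by (simp add: Suc_diff_le del: of_nat_diff)
  finally show ?thesis .
qed

section \<open>The coefficients \<open>Q n\<close> of the quantum product and their recursion in
  \<open>n\<close>\<close>

locale bivector_space = finite_dimensional_vector_space scale Basis
  for scale :: "'k::field_char_0 \<Rightarrow> 'v::ab_group_add \<Rightarrow> 'v" and Basis :: "'v set" +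
  fixes w :: "('v \<Rightarrow> 'k) \<Rightarrow> ('v \<Rightarrow> 'k) \<Rightarrow> 'k"
  assumes bivector: "bivector scale w"
begin

definition w_coeff :: "'v \<Rightarrow> 'v \<Rightarrow> 'k"
  where "w_coeff e f = w (dual_basis scale Basis e) (dual_basis scale Basis f)"

abbreviation Q :: "nat \<Rightarrow> ('v, 'k) form \<Rightarrow> ('v, 'k) form \<Rightarrow> ('v, 'k) form"
  where "Q \<equiv> qwedge_term scale Basis w"

lemma dual_basis_in_dual_space: "e \<in> Basis \<Longrightarrow> dual_basis scale Basis e \<in> dual_space scale"
  unfolding dual_space_def dual_basis_def mem_Collect_eq Vector_Spaces.linear_iff
  using independent_Basis span_Basis
  by (simp add: vector_space_axioms representation_add representation_scale) (simp add: vector_space_def algebra_simps)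

lemma w_coeff_skew: "e \<in> Basis \<Longrightarrow> f \<in> Basis \<Longrightarrow> w_coeff e f = - w_coeff f e"
  unfolding w_coeff_def
  by (rule bivector[unfolded bivector_def, THEN conjunct2, rule_format]; rule dual_basis_in_dual_space)

lemma Q_0: "Q 0 \<alpha> \<beta> = wedge \<alpha> \<beta>"
proof -
  have "{es. set es \<subseteq> Basis \<and> length es = 0} = {[]}" by auto
  then show ?thesis by (simp add: qwedge_term_def fun_eq_iff)
qed

text \<open>The heads of the two multi-indices are contracted first, so splitting them off leaves
  the \<open>n\<close>-th term for the contracted forms.\<close>

lemma Q_Suc: "Q (Suc n) \<alpha> \<beta> =
  inverse (of_nat (Suc n)) *\<^sub>f (\<Sum>e\<in>Basis. \<Sum>f\<in>Basis. w_coeff e f *\<^sub>f Q n (\<alpha> \<stileturn> e) (f \<turnstile> \<beta>))"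
proof
  fix vs
  define L where "L = {es. set es \<subseteq> Basis \<and> length es = n}"
  define P where "P es fs = (\<Prod>s<n. w_coeff (es ! s) (fs ! s))" for es fs
  define W where "W e f es fs = wedge (foldl (\<stileturn>) (\<alpha> \<stileturn> e) es) (fold (\<turnstile>) fs (f \<turnstile> \<beta>)) vs" for e f es fs
  have "Q (Suc n) \<alpha> \<beta> vs = 1 / fact (Suc n) *
      (\<Sum>e\<in>Basis. \<Sum>es\<in>L. \<Sum>f\<in>Basis. \<Sum>fs\<in>L. w_coeff e f * P es fs * W e f es fs)"
    unfolding qwedge_term_def sum_lists_Suc[OF finite_Basis] prod.lessThan_Suc_shift L_def P_def W_def w_coeff_def
    by simp
  also have "(\<Sum>e\<in>Basis. \<Sum>es\<in>L. \<Sum>f\<in>Basis. \<Sum>fs\<in>L. w_coeff e f * P es fs * W e f es fs) =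
      (\<Sum>e\<in>Basis. \<Sum>f\<in>Basis. \<Sum>es\<in>L. \<Sum>fs\<in>L. w_coeff e f * P es fs * W e f es fs)"
    by (intro sum.cong refl sum.swap)
  also have "1 / fact (Suc n) * \<dots> = inverse (of_nat (Suc n)) *
      (\<Sum>e\<in>Basis. \<Sum>f\<in>Basis. w_coeff e f * (1 / fact n * (\<Sum>es\<in>L. \<Sum>fs\<in>L. P es fs * W e f es fs)))"
    by (simp add: sum_distrib_left divide_simps mult.assoc mult.left_commute)
  also have "\<dots> = (inverse (of_nat (Suc n)) *\<^sub>f
      (\<Sum>e\<in>Basis. \<Sum>f\<in>Basis. w_coeff e f *\<^sub>f Q n (\<alpha> \<stileturn> e) (f \<turnstile> \<beta>))) vs"
    by (simp add: form_apply sum_form_apply qwedge_term_def L_def P_def W_def w_coeff_def)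
  finally show "Q (Suc n) \<alpha> \<beta> vs = \<dots>" .
qed

text \<open>The coefficient of \<open>h^n\<close> in the differential equation for the
  product.\<close>

lemma Q_Suc_scaled: "of_nat (Suc n) *\<^sub>f Q (Suc n) \<alpha> \<beta> =
  (\<Sum>e\<in>Basis. \<Sum>f\<in>Basis. w_coeff e f *\<^sub>f Q n (\<alpha> \<stileturn> e) (f \<turnstile> \<beta>))"
  unfolding Q_Suc form.scale_scale by (simp del: of_nat_Suc)

lemma form_linear_Q1: "form_linear (\<lambda>\<alpha>. Q n \<alpha> \<beta>)"
proof (induction n arbitrary: \<beta>)
  case 0
  then show ?case unfolding Q_0 by (rule form_linear_wedge1)
next
  case (Suc n)
  note IH = module_hom.add[OF Suc] module_hom.scale[OF Suc]
  show ?case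
    by (rule form_linearI)
       (simp_all add: Q_Suc rcontr_simps IH form.scale_right_distrib sum.distrib form.scale_sum_right
         mult.left_commute mult.commute)
qed

lemma form_linear_Q2: "form_linear (Q n \<alpha>)"
proof (induction n arbitrary: \<alpha>)
  case 0
  have "Q 0 \<alpha> = wedge \<alpha>" by (simp add: Q_0 fun_eq_iff)
  then show ?case by (simp add: form_linear_wedge2)
next
  case (Suc n)
  note IH = module_hom.add[OF Suc] module_hom.scale[OF Suc]
  show ?case
    by (rule form_linearI)
       (simp_all add: Q_Suc lcontr_simps IH form.scale_right_distrib sum.distrib form.scale_sum_right
         mult.left_commute mult.commute)
qed

lemmas Q_simps = module_hom.add[OF form_linear_Q1] module_hom.neg[OF form_linear_Q1]
  module_hom.scale[OF form_linear_Q1] module_hom.zero[OF form_linear_Q1]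
  module_hom.sum[OF form_linear_Q1]
  module_hom.add[OF form_linear_Q2] module_hom.neg[OF form_linear_Q2]
  module_hom.scale[OF form_linear_Q2] module_hom.zero[OF form_linear_Q2]
  module_hom.sum[OF form_linear_Q2]

text \<open>In the induction step two signs cancel: one from exchanging \<open>v\<close> and
  \<open>f\<close> on the alternating form \<beta>, one from moving \<open>parity\<close> past the
  contraction with \<open>e\<close>.\<close>

lemma lcontr_Q:
  assumes "alternating \<beta>"
  shows "v \<turnstile> Q n \<alpha> \<beta> = Q n (v \<turnstile> \<alpha>) \<beta> + Q n (parity \<alpha>) (v \<turnstile> \<beta>)"
  using assms
proof (induction n arbitrary: \<alpha> \<beta>)
  case 0
  then show ?case by (simp add: Q_0 lcontr_wedge)
next
  case (Suc n)
  have "v \<turnstile> Q n (\<alpha> \<stileturn> e) (f \<turnstile> \<beta>) =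
      Q n ((v \<turnstile> \<alpha>) \<stileturn> e) (f \<turnstile> \<beta>) + Q n (parity \<alpha> \<stileturn> e) (f \<turnstile> v \<turnstile> \<beta>)" for e f
    using Suc.IH[OF alternating_lcontr[OF Suc.prems]]
    by (simp add: lcontr_rcontr parity_rcontr lcontr_lcontr[OF Suc.prems, of v f] Q_simps)
  then show ?case
    by (simp add: Q_Suc lcontr_simps form.scale_right_distrib sum.distrib)
qed

text \<open>Mirror image of \<open>lcontr_Q\<close>: now \<open>e\<close> and \<open>v\<close> are
  exchanged on \<alpha>, and \<open>parity\<close> moves past the contraction with
  \<open>f\<close>.\<close>

lemma rcontr_Q:
  assumes "alternating \<alpha>"
  shows "Q n \<alpha> \<beta> \<stileturn> v = Q n \<alpha> (\<beta> \<stileturn> v) + Q n (\<alpha> \<stileturn> v) (parity \<beta>)"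
  using assms
proof (induction n arbitrary: \<alpha> \<beta>)
  case 0
  then show ?case by (simp add: Q_0 rcontr_wedge)
next
  case (Suc n)
  have "Q n (\<alpha> \<stileturn> e) (f \<turnstile> \<beta>) \<stileturn> v =
      Q n (\<alpha> \<stileturn> e) (f \<turnstile> (\<beta> \<stileturn> v)) + Q n (\<alpha> \<stileturn> v \<stileturn> e) (f \<turnstile> parity \<beta>)" for e f
    using Suc.IH[OF alternating_rcontr[OF Suc.prems]]
    by (simp add: lcontr_rcontr parity_lcontr rcontr_rcontr[OF Suc.prems, of e v] Q_simps)
  then show ?case
    by (simp add: Q_Suc rcontr_simps form.scale_right_distrib sum.distrib)
qed

text \<open>This is the coefficient of \<open>h^N\<close> in the associative law for forms without
  \<open>h\<close>. The induction is over all triples at once, since it passes to contracted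
  forms.\<close>

lemma Q_assoc:
  assumes "alternating \<alpha>" "alternating \<beta>" "alternating \<gamma>"
  shows "(\<Sum>a\<le>N. Q (N - a) (Q a \<alpha> \<beta>) \<gamma>) = (\<Sum>a\<le>N. Q (N - a) \<alpha> (Q a \<beta> \<gamma>))"
  using assms
proof (induction N arbitrary: \<alpha> \<beta> \<gamma>)
  case 0
  then show ?case by (simp add: Q_0 wedge_assoc)
next
  case (Suc N)
  define S where "S \<alpha> \<beta> \<gamma> = (\<Sum>a\<le>N. Q (N - a) (Q a \<alpha> \<beta>) \<gamma>)" for \<alpha> \<beta> \<gamma>
  define T where "T \<alpha> \<beta> \<gamma> = (\<Sum>a\<le>N. Q (N - a) \<alpha> (Q a \<beta> \<gamma>))" for \<alpha> \<beta> \<gamma>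
  have ST: "S \<alpha> \<beta> \<gamma> = T \<alpha> \<beta> \<gamma>" if "alternating \<alpha>" "alternating \<beta>" "alternating \<gamma>" for \<alpha> \<beta> \<gamma>
    unfolding S_def T_def using Suc.IH that by blast
  \<comment> \<open>The first summand is the derivative of the inner product; the other two come
    from the outer one, where \<open>rcontr_Q\<close> splits the contraction of
    \<open>Q a \<alpha> \<beta>\<close>.\<close>
  have S: "of_nat (Suc N) *\<^sub>f (\<Sum>a\<le>Suc N. Q (Suc N - a) (Q a \<alpha> \<beta>) \<gamma>) =
      (\<Sum>e\<in>Basis. \<Sum>f\<in>Basis. w_coeff e f *\<^sub>f
        (S (\<alpha> \<stileturn> e) (f \<turnstile> \<beta>) \<gamma> + (S \<alpha> (\<beta> \<stileturn> e) (f \<turnstile> \<gamma>) + S (\<alpha> \<stileturn> e) (parity \<beta>) (f \<turnstile> \<gamma>))))"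
  proof -
    have "of_nat (Suc a) *\<^sub>f Q (N - a) (Q (Suc a) \<alpha> \<beta>) \<gamma> =
      (\<Sum>e\<in>Basis. \<Sum>f\<in>Basis. w_coeff e f *\<^sub>f Q (N - a) (Q a (\<alpha> \<stileturn> e) (f \<turnstile> \<beta>)) \<gamma>)" for a
      using arg_cong[OF Q_Suc_scaled, of "\<lambda>\<delta>. Q (N - a) \<delta> \<gamma>" a \<alpha> \<beta>] by (simp only: Q_simps)
    moreover have "of_nat (Suc (N - a)) *\<^sub>f Q (Suc (N - a)) (Q a \<alpha> \<beta>) \<gamma> =
      (\<Sum>e\<in>Basis. \<Sum>f\<in>Basis. w_coeff e f *\<^sub>f
        (Q (N - a) (Q a \<alpha> (\<beta> \<stileturn> e)) (f \<turnstile> \<gamma>) + Q (N - a) (Q a (\<alpha> \<stileturn> e) (parity \<beta>)) (f \<turnstile> \<gamma>)))" for a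
      unfolding Q_Suc_scaled rcontr_Q[OF Suc.prems(1)] Q_simps ..
    ultimately show ?thesis
      unfolding sum_weighted_antidiagonal[of N "\<lambda>a b. Q b (Q a \<alpha> \<beta>) \<gamma>"] S_def
      by (simp add: form.scale_right_distrib form.scale_sum_right sum.distrib
          sum.swap[of _ Basis "{..N}"] del: of_nat_Suc)
  qed
  \<comment> \<open>Now the inner product yields the middle summand, and \<open>lcontr_Q\<close>,
    applied to \<open>Q a \<beta> \<gamma>\<close> in the outer one, yields the first and the
    last.\<close>
  have T: "of_nat (Suc N) *\<^sub>f (\<Sum>a\<le>Suc N. Q (Suc N - a) \<alpha> (Q a \<beta> \<gamma>)) =
      (\<Sum>e\<in>Basis. \<Sum>f\<in>Basis. w_coeff e f *\<^sub>f
        (T (\<alpha> \<stileturn> e) (f \<turnstile> \<beta>) \<gamma> + (T \<alpha> (\<beta> \<stileturn> e) (f \<turnstile> \<gamma>) + T (\<alpha> \<stileturn> e) (parity \<beta>) (f \<turnstile> \<gamma>))))"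
  proof -
    have "of_nat (Suc a) *\<^sub>f Q (N - a) \<alpha> (Q (Suc a) \<beta> \<gamma>) =
      (\<Sum>e\<in>Basis. \<Sum>f\<in>Basis. w_coeff e f *\<^sub>f Q (N - a) \<alpha> (Q a (\<beta> \<stileturn> e) (f \<turnstile> \<gamma>)))" for a
      using arg_cong[OF Q_Suc_scaled, of "Q (N - a) \<alpha>" a \<beta> \<gamma>] by (simp only: Q_simps)
    moreover have "of_nat (Suc (N - a)) *\<^sub>f Q (Suc (N - a)) \<alpha> (Q a \<beta> \<gamma>) =
      (\<Sum>e\<in>Basis. \<Sum>f\<in>Basis. w_coeff e f *\<^sub>f
        (Q (N - a) (\<alpha> \<stileturn> e) (Q a (f \<turnstile> \<beta>) \<gamma>) + Q (N - a) (\<alpha> \<stileturn> e) (Q a (parity \<beta>) (f \<turnstile> \<gamma>))))" for a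
      unfolding Q_Suc_scaled lcontr_Q[OF Suc.prems(3)] Q_simps ..
    ultimately show ?thesis
      unfolding sum_weighted_antidiagonal[of N "\<lambda>a b. Q b \<alpha> (Q a \<beta> \<gamma>)"] T_def
      by (simp add: form.scale_right_distrib form.scale_sum_right sum.distrib
          sum.swap[of _ Basis "{..N}"] add_ac del: of_nat_Suc)
  qed
  have "of_nat (Suc N) *\<^sub>f (\<Sum>a\<le>Suc N. Q (Suc N - a) (Q a \<alpha> \<beta>) \<gamma>) =
      of_nat (Suc N) *\<^sub>f (\<Sum>a\<le>Suc N. Q (Suc N - a) \<alpha> (Q a \<beta> \<gamma>))"
    unfolding S T
    by (simp add: ST Suc.prems alternating_lcontr alternating_rcontr alternating_parity)
  then show ?case
    \<comment> \<open>Characteristic zero allows \<open>Suc N\<close> to be cancelled.\<close>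
    by (subst (asm) form.scale_cancel_left) (simp del: of_nat_Suc)
qed

text \<open>Compared with \<open>wedge_commute\<close>, each recursion step produces one extra sign.
  Exchanging the factors also exchanges \<open>e\<close> and \<open>f\<close>, and
  \<open>w_coeff_skew\<close> absorbs that sign.\<close>

lemma Q_commute:
  assumes "alternating \<alpha>" "alternating \<beta>" "of_degree p \<alpha>" "of_degree q \<beta>"
  shows "Q n \<alpha> \<beta> = (-1) ^ (p * q) *\<^sub>f Q n \<beta> \<alpha>"
  using assms
proof (induction n arbitrary: \<alpha> \<beta> p q)
  case 0
  then show ?case unfolding Q_0 by (intro wedge_commute)
next
  case (Suc n)
  note alt = Suc.prems(1,2) and deg = Suc.prems(3,4)
  \<comment> \<open>The swap of factors contributes \<open>(p - 1) * (q - 1)\<close> signs, and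
    turning the two contractions around contributes \<open>p - 1\<close> and \<open>q - 1\<close>.
    The total is \<open>p * q - 1\<close>, hence the minus. If \<open>p\<close> or \<open>q\<close>
    is 0, both sides vanish.\<close>
  have "Q n (\<alpha> \<stileturn> e) (f \<turnstile> \<beta>) = - ((-1) ^ (p * q) *\<^sub>f Q n (\<beta> \<stileturn> f) (e \<turnstile> \<alpha>))" for e f
  proof (cases "p = 0 \<or> q = 0")
    case True
    then show ?thesis
      using of_degree_contr(3,4)[OF deg(1)] of_degree_contr(3,4)[OF deg(2)] by (auto simp: Q_simps)
  next
    case False
    then obtain p' q' where pq: "p = Suc p'" "q = Suc q'" by (metis not0_implies_Suc)
    have "Q n (\<alpha> \<stileturn> e) (f \<turnstile> \<beta>) = (-1) ^ (p' * q') *\<^sub>f Q n (f \<turnstile> \<beta>) (\<alpha> \<stileturn> e)"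
      using Suc.IH[of "\<alpha> \<stileturn> e" "f \<turnstile> \<beta>" p' q'] alt of_degree_contr[OF deg(1)] of_degree_contr[OF deg(2)]
      by (simp add: alternating_lcontr alternating_rcontr pq)
    also have "\<dots> = (-1) ^ (p' * q') *\<^sub>f (-1) ^ p' *\<^sub>f Q n (f \<turnstile> \<beta>) (e \<turnstile> \<alpha>)"
      by (simp add: rcontr_eq_lcontr[OF alt(1) deg(1)] Q_simps pq del: form.scale_scale)
    also have "\<dots> = (-1) ^ (p' * q') *\<^sub>f (-1) ^ p' *\<^sub>f Q n ((-1) ^ q' *\<^sub>f (\<beta> \<stileturn> f)) (e \<turnstile> \<alpha>)"
      by (simp add: rcontr_eq_lcontr[OF alt(2) deg(2)] pq flip: power_mult_distrib)
    finally show ?thesis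
      by (simp add: pq Q_simps power_add mult_ac flip: form.scale_minus_left)
  qed
  then have t: "w_coeff e f *\<^sub>f Q n (\<alpha> \<stileturn> e) (f \<turnstile> \<beta>) =
      (-1) ^ (p * q) *\<^sub>f (w_coeff f e *\<^sub>f Q n (\<beta> \<stileturn> f) (e \<turnstile> \<alpha>))"
    if "e \<in> Basis" "f \<in> Basis" for e f
    unfolding w_coeff_skew[OF that] by (simp add: mult.commute)
  have "Q (Suc n) \<alpha> \<beta> = inverse (of_nat (Suc n)) *\<^sub>f
      (\<Sum>e\<in>Basis. \<Sum>f\<in>Basis. (-1) ^ (p * q) *\<^sub>f (w_coeff f e *\<^sub>f Q n (\<beta> \<stileturn> f) (e \<turnstile> \<alpha>)))"
    by (simp only: Q_Suc t cong: sum.cong)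
  also have "\<dots> = (-1) ^ (p * q) *\<^sub>f Q (Suc n) \<beta> \<alpha>"
    unfolding Q_Suc by (subst sum.swap) (simp add: form.scale_sum_right mult.left_commute)
  finally show ?case .
qed

section \<open>Closure of the exterior algebra under the operations, and finiteness in
  \<open>n\<close>\<close>

definition multilinear :: "('v, 'k) form \<Rightarrow> bool"
  where "multilinear \<alpha> \<longleftrightarrow>
    (\<forall>us u v vs. \<alpha> (us @ (u + v) # vs) = \<alpha> (us @ u # vs) + \<alpha> (us @ v # vs)) \<and>
    (\<forall>us c v vs. \<alpha> (us @ scale c v # vs) = c * \<alpha> (us @ v # vs))"

lemma multilinearD:
  assumes "multilinear \<alpha>"
  shows "\<alpha> (us @ (u + v) # vs) = \<alpha> (us @ u # vs) + \<alpha> (us @ v # vs)"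
    and "\<alpha> (us @ scale c v # vs) = c * \<alpha> (us @ v # vs)"
  using assms unfolding multilinear_def by blast+

lemma multilinear_iff_linear:
  "multilinear \<alpha> \<longleftrightarrow> (\<forall>us vs. Vector_Spaces.linear scale (*) (\<lambda>v. \<alpha> (us @ v # vs)))"
proof -
  have "vector_space ((*) :: 'k \<Rightarrow> 'k \<Rightarrow> 'k)" by (simp add: vector_space_def algebra_simps)
  then show ?thesis
    unfolding multilinear_def Vector_Spaces.linear_iff using vector_space_axioms by blast
qed

text \<open>A degree bound stands in for finiteness of the set of nonzero components: it decreases
  under contraction, so inductions can run on it.\<close>

definition vanishes_above :: "nat \<Rightarrow> ('v, 'k) form \<Rightarrow> bool"
  where "vanishes_above K \<alpha> \<longleftrightarrow> (\<forall>vs. length vs > K \<longrightarrow> \<alpha> vs = 0)"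

lemma vanishes_above_mono: "vanishes_above K \<alpha> \<Longrightarrow> K \<le> L \<Longrightarrow> vanishes_above L \<alpha>"
  by (auto simp: vanishes_above_def)

lemma vanishes_above_contr:
  assumes "vanishes_above K \<alpha>"
  shows "K = 0 \<Longrightarrow> v \<turnstile> \<alpha> = 0" "K = 0 \<Longrightarrow> \<alpha> \<stileturn> v = 0"
    "K = Suc L \<Longrightarrow> vanishes_above L (v \<turnstile> \<alpha>)" "K = Suc L \<Longrightarrow> vanishes_above L (\<alpha> \<stileturn> v)"
  using assms by (auto simp: vanishes_above_def lcontr_def rcontr_def fun_eq_iff form_apply)

text \<open>Once the two copies are neighbours, swapping them shows that the value equals its
  negative, hence is 0 in characteristic zero.\<close>

lemma alternating_repeat:
  fixes \<alpha> :: "('v, 'k) form"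
  assumes "alternating \<alpha>"
  shows "\<alpha> (us @ v # vs @ v # ws) = 0"
proof -
  have "\<alpha> (us @ v # v # vs @ ws) = - \<alpha> (us @ v # v # vs @ ws)"
    by (rule alternatingD[OF assms])
  then show ?thesis
    using alternating_move[OF assms, of "us @ [v]" vs v ws] by (simp add: eq_neg_iff_add_eq_0)
qed

text \<open>The length of the argument list selects the component, so the conditions on all
  components merge into three conditions on the whole form, which can be checked separately for each
  operation.\<close>

lemma ext_alg_iff:
  "\<alpha> \<in> ext_alg scale \<longleftrightarrow> multilinear \<alpha> \<and> alternating \<alpha> \<and> (\<exists>K. vanishes_above K \<alpha>)"
proof
  assume \<alpha>: "\<alpha> \<in> ext_alg scale"
  have "Vector_Spaces.linear scale (*) (\<lambda>v. \<alpha> (us @ v # vs))" for us vs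
  proof -
    define k where "k = length us + 1 + length vs"
    have "component k \<alpha> \<in> ext_pow scale k" using \<alpha> by (simp add: ext_alg_def)
    then have "Vector_Spaces.linear scale (*) (\<lambda>v. component k \<alpha> (us @ v # vs))"
      unfolding ext_pow_def k_def by blast
    then show ?thesis by (simp add: component_def k_def)
  qed
  then have m: "multilinear \<alpha>" by (simp add: multilinear_iff_linear)
  have "\<alpha> (us @ u # v # vs) = - \<alpha> (us @ v # u # vs)" for us u v vs
  proof -
    define k where "k = length us + 2 + length vs"
    have "component k \<alpha> \<in> ext_pow scale k" using \<alpha> by (simp add: ext_alg_def)
    then have "component k \<alpha> (us @ x # [] @ x # vs) = 0" for x
      unfolding ext_pow_def by blast
    then have r: "\<alpha> (us @ x # x # vs) = 0" for x by (simp add: component_def k_def)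
    have m': "\<alpha> (us @ x # (u + v) # vs) = \<alpha> (us @ x # u # vs) + \<alpha> (us @ x # v # vs)" for x
      using multilinearD(1)[OF m, of "us @ [x]" u v vs] by simp
    \<comment> \<open>Polarization: vanishing on a repeated \<open>u + v\<close> leaves only the two
      mixed terms.\<close>
    have "0 = \<alpha> (us @ (u + v) # (u + v) # vs)" by (simp add: r)
    also have "\<dots> = \<alpha> (us @ u # v # vs) + \<alpha> (us @ v # u # vs)"
      unfolding multilinearD(1)[OF m, of us u v] m' by (simp add: r)
    finally show ?thesis by (simp add: eq_neg_iff_add_eq_0)
  qed
  then have a: "alternating \<alpha>" unfolding alternating_def by blast
  obtain K where K: "{k. component k \<alpha> \<noteq> 0} \<subseteq> {..K}"
    using \<alpha> finite_nat_iff_bounded_le[of "{k. component k \<alpha> \<noteq> 0}"] by (auto simp: ext_alg_def)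
  have "\<alpha> vs = 0" if "length vs > K" for vs
  proof -
    have "component (length vs) \<alpha> = 0" using K that by force
    then have "component (length vs) \<alpha> vs = 0" by (simp add: form_apply)
    then show ?thesis by (simp add: component_def)
  qed
  then have "vanishes_above K \<alpha>" by (simp add: vanishes_above_def)
  with m a show "multilinear \<alpha> \<and> alternating \<alpha> \<and> (\<exists>K. vanishes_above K \<alpha>)" by blast
next
  assume "multilinear \<alpha> \<and> alternating \<alpha> \<and> (\<exists>K. vanishes_above K \<alpha>)"
  then obtain K where m: "multilinear \<alpha>" and a: "alternating \<alpha>" and K: "vanishes_above K \<alpha>" by blast
  have "component k \<alpha> \<in> ext_pow scale k" for k
    using m alternating_repeat[OF a] by (auto simp: ext_pow_def component_def multilinear_iff_linear)
  moreover have "{k. component k \<alpha> \<noteq> 0} \<subseteq> {..K}"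
    using K by (auto simp: component_def vanishes_above_def fun_eq_iff form_apply not_less split: if_splits)
  ultimately show "\<alpha> \<in> ext_alg scale"
    using finite_subset[of _ "{..K}"] by (auto simp: ext_alg_def)
qed

lemma ext_algD:
  assumes "\<alpha> \<in> ext_alg scale"
  shows "multilinear \<alpha>" "alternating \<alpha>" "\<exists>K. vanishes_above K \<alpha>"
  using assms by (auto simp: ext_alg_iff)

lemma ext_alg_add:
  assumes "\<alpha> \<in> ext_alg scale" "\<beta> \<in> ext_alg scale"
  shows "\<alpha> + \<beta> \<in> ext_alg scale"
proof -
  obtain K L where "vanishes_above K \<alpha>" "vanishes_above L \<beta>"
    using assms by (auto simp: ext_alg_iff)
  then have "vanishes_above (max K L) (\<alpha> + \<beta>)"
    by (auto simp: vanishes_above_def form_apply)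
  moreover have "multilinear (\<alpha> + \<beta>)"
    unfolding multilinear_def form_apply multilinearD[OF ext_algD(1)[OF assms(1)]]
      multilinearD[OF ext_algD(1)[OF assms(2)]] by (simp add: algebra_simps)
  moreover have "alternating (\<alpha> + \<beta>)"
    unfolding alternating_def form_apply
  proof (intro allI)
    fix us u v vs
    show "\<alpha> (us @ u # v # vs) + \<beta> (us @ u # v # vs) = - (\<alpha> (us @ v # u # vs) + \<beta> (us @ v # u # vs))"
      unfolding alternatingD[OF ext_algD(2)[OF assms(1)], of us u v]
        alternatingD[OF ext_algD(2)[OF assms(2)], of us u v] by simp
  qed
  ultimately show ?thesis by (auto simp: ext_alg_iff)
qed

lemma ext_alg_scale:
  assumes "\<alpha> \<in> ext_alg scale"
  shows "c *\<^sub>f \<alpha> \<in> ext_alg scale"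
proof -
  obtain K where "vanishes_above K \<alpha>" using assms by (auto simp: ext_alg_iff)
  then have "vanishes_above K (c *\<^sub>f \<alpha>)" by (auto simp: vanishes_above_def form_apply)
  moreover have "multilinear (c *\<^sub>f \<alpha>)"
    unfolding multilinear_def form_apply multilinearD[OF ext_algD(1)[OF assms(1)]]
    by (simp add: algebra_simps)
  moreover have "alternating (c *\<^sub>f \<alpha>)"
    unfolding alternating_def form_apply
  proof (intro allI)
    fix us u v vs
    show "c * \<alpha> (us @ u # v # vs) = - (c * \<alpha> (us @ v # u # vs))"
      unfolding alternatingD[OF ext_algD(2)[OF assms(1)], of us u v] by simp
  qed
  ultimately show ?thesis by (auto simp: ext_alg_iff)
qed

lemma ext_alg_zero: "0 \<in> ext_alg scale"
  by (auto simp: ext_alg_iff multilinear_def alternating_def vanishes_above_def form_apply)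

lemma ext_alg_sum: "(\<And>x. x \<in> X \<Longrightarrow> g x \<in> ext_alg scale) \<Longrightarrow> sum g X \<in> ext_alg scale"
  by (induction X rule: infinite_finite_induct) (auto simp: ext_alg_zero ext_alg_add)

lemma multilinear_parity: "multilinear \<alpha> \<Longrightarrow> multilinear (parity \<alpha>)"
  unfolding multilinear_def parity_def by (simp add: algebra_simps)

lemma multilinear_lcontr: "multilinear \<alpha> \<Longrightarrow> multilinear (v \<turnstile> \<alpha>)"
  unfolding multilinear_def lcontr_def append_Cons[symmetric] by blast

lemma multilinear_rcontr: "multilinear \<alpha> \<Longrightarrow> multilinear (\<alpha> \<stileturn> v)"
  unfolding multilinear_def rcontr_def append.assoc append_Cons by blast

lemma multilinear_lcontr_linear:
  assumes "multilinear \<alpha>"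
  shows "(u + v) \<turnstile> \<alpha> = u \<turnstile> \<alpha> + v \<turnstile> \<alpha>" "scale c v \<turnstile> \<alpha> = c *\<^sub>f (v \<turnstile> \<alpha>)"
  using multilinearD[OF assms, of "[]"] by (auto simp: lcontr_def fun_eq_iff form_apply)

lemma multilinear_wedge:
  assumes "multilinear \<alpha>" "multilinear \<beta>"
  shows "multilinear (wedge \<alpha> \<beta>)"
proof -
  have "wedge \<alpha> \<beta> (us @ (u + v) # vs) = wedge \<alpha> \<beta> (us @ u # vs) + wedge \<alpha> \<beta> (us @ v # vs) \<and>
      wedge \<alpha> \<beta> (us @ scale c v # vs) = c * wedge \<alpha> \<beta> (us @ v # vs)" for us u v vs c
    using assms
  proof (induction us arbitrary: \<alpha> \<beta>)
    case Nil
    then show ?case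
      by (simp add: wedge_Cons multilinear_lcontr_linear wedge_simps form_apply algebra_simps)
  next
    case (Cons x us)
    then show ?case
      by (simp add: wedge_Cons multilinear_lcontr multilinear_parity algebra_simps)
  qed
  then show ?thesis unfolding multilinear_def by blast
qed

text \<open>For a swap at the front, \<open>wedge_Cons\<close> applied twice gives four terms: those
  with both vectors in one factor change sign by \<open>lcontr_lcontr\<close>, and the two mixed
  ones are exchanged with opposite signs.\<close>

lemma alternating_wedge:
  fixes \<alpha> \<beta> :: "('v, 'k) form"
  assumes "alternating \<alpha>" "alternating \<beta>"
  shows "alternating (wedge \<alpha> \<beta>)"
proof -
  have "wedge \<alpha> \<beta> (us @ u # v # vs) = - wedge \<alpha> \<beta> (us @ v # u # vs)" for us u v vs
    using assms
  proof (induction us arbitrary: \<alpha> \<beta>)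
    case Nil
    have l: "v \<turnstile> parity \<gamma> = - parity (v \<turnstile> \<gamma>)" for v and \<gamma> :: "('v, 'k) form" by (simp add: parity_lcontr)
    show ?case
      by (simp add: wedge_Cons l wedge_simps form_apply lcontr_lcontr[OF Nil(1), of v u] lcontr_lcontr[OF Nil(2), of v u])
  next
    case (Cons x us)
    then show ?case
      by (simp only: append_Cons wedge_Cons alternating_lcontr alternating_parity Cons.IH) simp
  qed
  then show ?thesis unfolding alternating_def by blast
qed

lemma vanishes_above_wedge:
  assumes "vanishes_above K \<alpha>" "vanishes_above L \<beta>"
  shows "vanishes_above (K + L) (wedge \<alpha> \<beta>)"
proof -
  have "wedge \<alpha> \<beta> vs = 0" if "length vs > K + L" for vs
    using assms that
  proof (induction vs arbitrary: \<alpha> \<beta> K L)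
    case (Cons v vs)
    have p: "vanishes_above K (parity \<alpha>)" using Cons.prems(1) by (simp add: vanishes_above_def parity_def)
    have "wedge (v \<turnstile> \<alpha>) \<beta> vs = 0"
      using Cons.IH[OF vanishes_above_contr(3)[OF Cons.prems(1)] Cons.prems(2)] Cons.prems(3)
        vanishes_above_contr(1)[OF Cons.prems(1)]
      by (cases K) (simp_all add: wedge_simps form_apply)
    moreover have "wedge (parity \<alpha>) (v \<turnstile> \<beta>) vs = 0"
      using Cons.IH[OF p vanishes_above_contr(3)[OF Cons.prems(2)]] Cons.prems(3)
        vanishes_above_contr(1)[OF Cons.prems(2)]
      by (cases L) (simp_all add: wedge_simps form_apply)
    ultimately show ?case by (simp add: wedge_Cons)
  qed simp
  then show ?thesis by (simp add: vanishes_above_def)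
qed

lemma ext_alg_wedge: "\<alpha> \<in> ext_alg scale \<Longrightarrow> \<beta> \<in> ext_alg scale \<Longrightarrow> wedge \<alpha> \<beta> \<in> ext_alg scale"
  unfolding ext_alg_iff using multilinear_wedge alternating_wedge vanishes_above_wedge by blast

lemma ext_alg_contr:
  assumes "\<alpha> \<in> ext_alg scale"
  shows "v \<turnstile> \<alpha> \<in> ext_alg scale" "\<alpha> \<stileturn> v \<in> ext_alg scale"
proof -
  obtain K where "vanishes_above K \<alpha>" using assms by (auto simp: ext_alg_iff)
  then have K: "vanishes_above (Suc K) \<alpha>" using vanishes_above_mono by simp
  show "v \<turnstile> \<alpha> \<in> ext_alg scale" "\<alpha> \<stileturn> v \<in> ext_alg scale"
    using ext_algD(1,2)[OF assms] vanishes_above_contr(3,4)[OF K refl, of v]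
    unfolding ext_alg_iff
    by (auto intro: multilinear_lcontr multilinear_rcontr alternating_lcontr alternating_rcontr)
qed

lemma ext_alg_Q: "\<alpha> \<in> ext_alg scale \<Longrightarrow> \<beta> \<in> ext_alg scale \<Longrightarrow> Q n \<alpha> \<beta> \<in> ext_alg scale"
proof (induction n arbitrary: \<alpha> \<beta>)
  case 0
  then show ?case unfolding Q_0 by (rule ext_alg_wedge)
next
  case (Suc n)
  then show ?case unfolding Q_Suc by (intro ext_alg_scale ext_alg_sum) (simp add: ext_alg_contr)
qed

text \<open>Each recursion step contracts \<alpha> once more, which is possible without vanishing at
  most \<open>K\<close> times.\<close>

lemma Q_eq_0: "vanishes_above K \<alpha> \<Longrightarrow> n > K \<Longrightarrow> Q n \<alpha> \<beta> = 0"
proof (induction n arbitrary: \<alpha> \<beta> K)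
  case (Suc n)
  have "Q n (\<alpha> \<stileturn> e) (f \<turnstile> \<beta>) = 0" for e f
    using Suc.IH[OF vanishes_above_contr(4)[OF Suc.prems(1)]] Suc.prems(2)
      vanishes_above_contr(2)[OF Suc.prems(1)]
    by (cases K) (simp_all add: Q_simps)
  then show ?case by (simp add: Q_Suc)
qed simp

section \<open>Extension to polynomials in \<open>h\<close>\<close>

text \<open>\<open>Sum_any\<close> is 0 on infinite support, so the degree bound of \<alpha> enters
  here: it confines the support to \<open>{..K}\<close>.\<close>

lemma coeff_qwedge:
  assumes "\<alpha> \<in> ext_alg scale"
  shows "coeff (qwedge scale Basis w \<alpha> \<beta>) n = Q n \<alpha> \<beta>"
proof -
  obtain K where K: "vanishes_above K \<alpha>" using ext_algD(3)[OF assms] by blast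
  have 0: "Q m \<alpha> \<beta> = 0" if "m \<notin> {..K}" for m using Q_eq_0[OF K] that by simp
  have "qwedge scale Basis w \<alpha> \<beta> = (\<Sum>m\<le>K. monom (Q m \<alpha> \<beta>) m)"
    unfolding qwedge_def by (rule Sum_any.expand_superset) (use 0 in fastforce)+
  then show ?thesis using 0[of n] by (auto simp: coeff_sum)
qed

text \<open>The contribution of \<open>h^i\<close> \<alpha> and \<open>h^j\<close> \<beta> to the
  coefficient of \<open>h^N\<close>. The case distinction guards against truncated
  subtraction.\<close>

definition qterm :: "nat \<Rightarrow> nat \<Rightarrow> nat \<Rightarrow> ('v, 'k) form \<Rightarrow> ('v, 'k) form \<Rightarrow> ('v, 'k) form"
  where "qterm N i j \<alpha> \<beta> = (if i + j \<le> N then Q (N - (i + j)) \<alpha> \<beta> else 0)"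

lemma qterm_simps:
  "qterm N i j (\<alpha> + \<alpha>') \<beta> = qterm N i j \<alpha> \<beta> + qterm N i j \<alpha>' \<beta>"
  "qterm N i j \<alpha> (\<beta> + \<beta>') = qterm N i j \<alpha> \<beta> + qterm N i j \<alpha> \<beta>'"
  "qterm N i j (c *\<^sub>f \<alpha>) \<beta> = c *\<^sub>f qterm N i j \<alpha> \<beta>"
  "qterm N i j \<alpha> (c *\<^sub>f \<beta>) = c *\<^sub>f qterm N i j \<alpha> \<beta>"
  "qterm N i j 0 \<beta> = 0" "qterm N i j \<alpha> 0 = 0"
  by (simp_all add: qterm_def Q_simps)

abbreviation qh :: "('v, 'k) form poly \<Rightarrow> ('v, 'k) form poly \<Rightarrow> ('v, 'k) form poly"
  where "qh \<equiv> qwedge_h scale Basis w"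

text \<open>Arbitrary bounds replace the exact degrees, so that several products can be summed over
  a common range even if degrees drop.\<close>

lemma coeff_qh:
  assumes A: "A \<in> ext_alg_h scale" and M: "degree A \<le> M" and M': "degree C \<le> M'"
  shows "coeff (qh A C) N = (\<Sum>i\<le>M. \<Sum>j\<le>M'. qterm N i j (coeff A i) (coeff C j))"
proof -
  have a: "coeff A i \<in> ext_alg scale" for i using A by (simp add: ext_alg_h_def)
  \<comment> \<open>The constant function 1 is the unit of the pointwise product, so
    \<open>scale_h (monom 1 m)\<close> multiplies by \<open>h^m\<close>.\<close>
  have 1: "map_poly (\<lambda>(c::'k) _. c) (monom 1 m) = (monom 1 m :: ('v, 'k) form poly)" for m
    by (subst map_poly_monom) (auto simp: zero_fun_def one_fun_def)
  have "coeff (scale_h (monom 1 (i + j)) (qwedge scale Basis w (coeff A i) (coeff C j))) N =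
      qterm N i j (coeff A i) (coeff C j)" for i j
    unfolding scale_h_def 1 qterm_def by (simp add: coeff_monom_mult coeff_qwedge[OF a])
  then have "coeff (qh A C) N = (\<Sum>i\<le>degree A. \<Sum>j\<le>degree C. qterm N i j (coeff A i) (coeff C j))"
    by (simp add: qwedge_h_def coeff_sum)
  also have "\<dots> = (\<Sum>i\<le>degree A. \<Sum>j\<le>M'. qterm N i j (coeff A i) (coeff C j))"
    using M' by (intro sum.cong refl sum.mono_neutral_left) (auto simp: coeff_eq_0 qterm_simps)
  also have "\<dots> = (\<Sum>i\<le>M. \<Sum>j\<le>M'. qterm N i j (coeff A i) (coeff C j))"
    using M by (intro sum.mono_neutral_left) (auto simp: coeff_eq_0 qterm_simps)
  finally show ?thesis .
qed

lemma const_mult_form: "(\<lambda>_. c) * \<alpha> = c *\<^sub>f \<alpha>" for \<alpha> :: "('v, 'k) form"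
  by (auto simp: fun_eq_iff form_apply)

lemma coeff_smult_const: "coeff (smult (\<lambda>_. c) A) n = c *\<^sub>f coeff A n" for A :: "('v, 'k) form poly"
  by (simp add: const_mult_form)

lemma ext_alg_h_0: "0 \<in> ext_alg_h scale"
  by (simp add: ext_alg_h_def ext_alg_zero)

lemma ext_alg_h_add: "A \<in> ext_alg_h scale \<Longrightarrow> B \<in> ext_alg_h scale \<Longrightarrow> A + B \<in> ext_alg_h scale"
  by (simp add: ext_alg_h_def ext_alg_add)

lemma ext_alg_h_smult: "A \<in> ext_alg_h scale \<Longrightarrow> smult (\<lambda>_. c) A \<in> ext_alg_h scale"
  unfolding ext_alg_h_def mem_Collect_eq coeff_smult_const by (simp add: ext_alg_scale)

lemma ext_alg_h_pCons: "pCons \<alpha> A \<in> ext_alg_h scale \<longleftrightarrow> \<alpha> \<in> ext_alg scale \<and> A \<in> ext_alg_h scale"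
proof -
  have "(\<forall>n. P n) \<longleftrightarrow> P 0 \<and> (\<forall>n. P (Suc n))" for P by (metis not0_implies_Suc)
  from this[of "\<lambda>n. coeff (pCons \<alpha> A) n \<in> ext_alg scale"] show ?thesis by (simp add: ext_alg_h_def)
qed

lemma ext_alg_h_qh:
  assumes "A \<in> ext_alg_h scale" "C \<in> ext_alg_h scale"
  shows "qh A C \<in> ext_alg_h scale"
  using assms unfolding ext_alg_h_def mem_Collect_eq coeff_qh[OF assms(1) order.refl order.refl]
  by (auto intro!: ext_alg_sum simp: qterm_def ext_alg_Q ext_alg_zero)

lemma qh_add:
  assumes "A \<in> ext_alg_h scale" "B \<in> ext_alg_h scale"
  shows "qh (A + B) C = qh A C + qh B C" "qh A (B + C) = qh A B + qh A C"
proof (rule_tac [!] poly_eqI)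
  fix N
  define M where "M = max (degree A) (max (degree B) (degree C))"
  have M: "degree A \<le> M" "degree B \<le> M" "degree C \<le> M" "degree (A + B) \<le> M" "degree (B + C) \<le> M"
    by (auto simp: M_def intro: order.trans[OF degree_add_le_max])
  show "coeff (qh (A + B) C) N = coeff (qh A C + qh B C) N"
    by (simp add: coeff_qh[OF ext_alg_h_add[OF assms] M(4) M(3)] coeff_qh[OF assms(1) M(1) M(3)]
        coeff_qh[OF assms(2) M(2) M(3)] qterm_simps sum.distrib)
  show "coeff (qh A (B + C)) N = coeff (qh A B + qh A C) N"
    by (simp add: coeff_qh[OF assms(1) M(1) M(5)] coeff_qh[OF assms(1) M(1) M(2)]
        coeff_qh[OF assms(1) M(1) M(3)] qterm_simps sum.distrib)
qed

lemma qh_smult: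
  assumes "A \<in> ext_alg_h scale"
  shows "qh (smult (\<lambda>_. c) A) C = smult (\<lambda>_. c) (qh A C)" "qh A (smult (\<lambda>_. c) C) = smult (\<lambda>_. c) (qh A C)"
proof (rule_tac [!] poly_eqI)
  fix N
  show "coeff (qh (smult (\<lambda>_. c) A) C) N = coeff (smult (\<lambda>_. c) (qh A C)) N"
    unfolding coeff_qh[OF ext_alg_h_smult[OF assms] degree_smult_le order.refl]
    by (simp only: coeff_smult_const form.scale_sum_right qterm_simps coeff_qh[OF assms order.refl order.refl])
  show "coeff (qh A (smult (\<lambda>_. c) C)) N = coeff (smult (\<lambda>_. c) (qh A C)) N"
    unfolding coeff_qh[OF assms order.refl degree_smult_le]
    by (simp only: coeff_smult_const form.scale_sum_right qterm_simps coeff_qh[OF assms order.refl order.refl])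
qed

lemma qterm_Suc: "qterm N (Suc i) j = (case N of 0 \<Rightarrow> (\<lambda>_ _. 0) | Suc N' \<Rightarrow> qterm N' i j)"
    "qterm N i (Suc j) = (case N of 0 \<Rightarrow> (\<lambda>_ _. 0) | Suc N' \<Rightarrow> qterm N' i j)"
  by (auto simp: qterm_def fun_eq_iff split: nat.split)

text \<open>\<open>pCons 0\<close> is multiplication by \<open>h\<close>.\<close>

lemma qh_pCons:
  assumes "A \<in> ext_alg_h scale"
  shows "qh (pCons 0 A) C = pCons 0 (qh A C)" "qh A (pCons 0 C) = pCons 0 (qh A C)"
proof (rule_tac [!] poly_eqI)
  fix N
  have p: "pCons 0 A \<in> ext_alg_h scale" using assms by (simp add: ext_alg_h_pCons ext_alg_zero)
  show "coeff (qh (pCons 0 A) C) N = coeff (pCons 0 (qh A C)) N"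
    unfolding coeff_qh[OF p degree_pCons_le order.refl] sum.atMost_Suc_shift
    by (cases N) (simp_all add: coeff_qh[OF assms order.refl order.refl] qterm_Suc qterm_simps)
  show "coeff (qh A (pCons 0 C)) N = coeff (pCons 0 (qh A C)) N"
    unfolding coeff_qh[OF assms order.refl degree_pCons_le] sum.atMost_Suc_shift
    by (cases N) (simp_all add: coeff_qh[OF assms order.refl order.refl] qterm_Suc qterm_simps)
qed

lemma scale_h_pCons: "scale_h (pCons c p) A = smult (\<lambda>_. c) A + pCons 0 (scale_h p A)"
  for A :: "('v, 'k) form poly"
  by (simp add: scale_h_def map_poly_pCons zero_fun_def[symmetric])

lemma scale_h_0: "scale_h 0 A = 0" for A :: "('v, 'k) form poly"
  by (simp add: scale_h_def)

lemma ext_alg_h_scale_h: "A \<in> ext_alg_h scale \<Longrightarrow> scale_h p A \<in> ext_alg_h scale"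
  by (induction p)
     (auto simp: scale_h_0 scale_h_pCons ext_alg_h_0 ext_alg_zero ext_alg_h_pCons
        intro!: ext_alg_h_add ext_alg_h_smult)

lemma qh_0: "qh 0 C = 0" "A \<in> ext_alg_h scale \<Longrightarrow> qh A 0 = 0"
  using coeff_qh[OF ext_alg_h_0, of 0 C] coeff_qh[of A _ 0] by (auto simp: poly_eq_iff qterm_simps)

text \<open>Writing the scalar in Horner form reduces the claim to constants, sums and
  multiplication by \<open>h\<close>.\<close>

lemma qh_scale_h:
  assumes "A \<in> ext_alg_h scale" "C \<in> ext_alg_h scale"
  shows "qh (scale_h p A) C = scale_h p (qh A C)" "qh A (scale_h p C) = scale_h p (qh A C)"
proof (induction p)
  case (pCons c p)
  {
    case 1
    then show ?case using pCons
      by (simp add: scale_h_pCons qh_add qh_smult qh_pCons assms ext_alg_h_smult ext_alg_h_scale_h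
          ext_alg_h_pCons ext_alg_zero)
  next
    case 2
    then show ?case using pCons
      by (simp add: scale_h_pCons qh_add qh_smult qh_pCons assms ext_alg_h_smult ext_alg_h_scale_h
          ext_alg_h_pCons ext_alg_zero)
  }
qed (simp_all add: scale_h_0 qh_0 assms)

text \<open>Constants generate \<open>ext_alg_h\<close> under sums and multiplication by
  \<open>h\<close>; this reduces associativity to forms without \<open>h\<close>.\<close>

lemma ext_alg_h_induct [consumes 1, case_names const add shift]:
  assumes "A \<in> ext_alg_h scale"
    and c: "\<And>\<alpha>. \<alpha> \<in> ext_alg scale \<Longrightarrow> P [:\<alpha>:]"
    and a: "\<And>A B. A \<in> ext_alg_h scale \<Longrightarrow> B \<in> ext_alg_h scale \<Longrightarrow> P A \<Longrightarrow> P B \<Longrightarrow> P (A + B)"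
    and s: "\<And>A. A \<in> ext_alg_h scale \<Longrightarrow> P A \<Longrightarrow> P (pCons 0 A)"
  shows "P A"
  using assms(1)
proof (induction A)
  case 0
  show ?case using c[OF ext_alg_zero] by simp
next
  case (pCons \<alpha> A)
  then have \<alpha>: "\<alpha> \<in> ext_alg scale" and A: "A \<in> ext_alg_h scale" by (auto simp: ext_alg_h_pCons)
  have "P ([:\<alpha>:] + pCons 0 A)"
    by (intro a c s) (use \<alpha> A pCons.IH in \<open>auto simp: ext_alg_h_pCons ext_alg_zero ext_alg_h_0\<close>)
  then show ?case by simp
qed

lemma qh_assoc_const:
  assumes "\<alpha> \<in> ext_alg scale" "\<beta> \<in> ext_alg scale" "\<gamma> \<in> ext_alg scale"
  shows "qh (qh [:\<alpha>:] [:\<beta>:]) [:\<gamma>:] = qh [:\<alpha>:] (qh [:\<beta>:] [:\<gamma>:])"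
proof (rule poly_eqI)
  fix N
  have ext: "[:\<alpha>:] \<in> ext_alg_h scale" "[:\<beta>:] \<in> ext_alg_h scale" "[:\<gamma>:] \<in> ext_alg_h scale"
    using assms by (auto simp: ext_alg_h_pCons ext_alg_h_0)
  have c: "coeff (qh [:\<delta>:] [:\<epsilon>:]) n = Q n \<delta> \<epsilon>" if "[:\<delta>:] \<in> ext_alg_h scale" for \<delta> \<epsilon> n
    using coeff_qh[OF that, of 0 "[:\<epsilon>:]" 0 n] by (simp add: qterm_def)
  \<comment> \<open>\<open>M\<close> bounds the degrees of both inner products and also
    \<open>N\<close>, so the sums can be cut to \<open>{..N}\<close>, beyond which
    \<open>qterm\<close> is 0.\<close>
  define M where "M = N + degree (qh [:\<alpha>:] [:\<beta>:]) + degree (qh [:\<beta>:] [:\<gamma>:])"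
  have "coeff (qh (qh [:\<alpha>:] [:\<beta>:]) [:\<gamma>:]) N = (\<Sum>i\<le>M. qterm N i 0 (Q i \<alpha> \<beta>) \<gamma>)"
    using coeff_qh[OF ext_alg_h_qh[OF ext(1,2)], of M "[:\<gamma>:]" 0 N] by (simp add: M_def c ext)
  also have "\<dots> = (\<Sum>i\<le>N. Q (N - i) (Q i \<alpha> \<beta>) \<gamma>)"
    by (rule sum.mono_neutral_cong_right) (auto simp: M_def qterm_def)
  also have "\<dots> = (\<Sum>i\<le>N. Q (N - i) \<alpha> (Q i \<beta> \<gamma>))"
    using assms by (intro Q_assoc ext_algD)
  also have "\<dots> = (\<Sum>i\<le>M. qterm N 0 i \<alpha> (Q i \<beta> \<gamma>))"
    by (rule sum.mono_neutral_cong_left) (auto simp: M_def qterm_def)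
  also have "\<dots> = coeff (qh [:\<alpha>:] (qh [:\<beta>:] [:\<gamma>:])) N"
    using coeff_qh[OF ext(1), of 0 "qh [:\<beta>:] [:\<gamma>:]" M N] by (simp add: M_def c ext)
  finally show "coeff (qh (qh [:\<alpha>:] [:\<beta>:]) [:\<gamma>:]) N = coeff (qh [:\<alpha>:] (qh [:\<beta>:] [:\<gamma>:])) N" .
qed

text \<open>Both sides are additive and commute with \<open>h\<close> in each argument, so three
  nested inductions lead to \<open>qh_assoc_const\<close>.\<close>

lemma qh_assoc:
  assumes "A \<in> ext_alg_h scale" "B \<in> ext_alg_h scale" "C \<in> ext_alg_h scale"
  shows "qh (qh A B) C = qh A (qh B C)"
  using assms
proof (induction A arbitrary: B C rule: ext_alg_h_induct)
  case (const \<alpha>)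
  then have \<alpha>: "[:\<alpha>:] \<in> ext_alg_h scale" by (simp add: ext_alg_h_pCons ext_alg_h_0)
  from const(2,3) show ?case
  proof (induction B arbitrary: C rule: ext_alg_h_induct)
    case (const \<beta>)
    then have \<beta>: "[:\<beta>:] \<in> ext_alg_h scale" by (simp add: ext_alg_h_pCons ext_alg_h_0)
    from const(2) show ?case
    proof (induction C rule: ext_alg_h_induct)
      case (const \<gamma>)
      then show ?case using \<open>\<alpha> \<in> _\<close> \<open>\<beta> \<in> _\<close> by (intro qh_assoc_const)
    qed (simp_all add: qh_add qh_pCons ext_alg_h_qh \<alpha> \<beta>)
  qed (simp_all add: qh_add qh_pCons ext_alg_h_qh \<alpha>)
qed (simp_all add: qh_add qh_pCons ext_alg_h_qh)

section \<open>Homogeneous elements, supercommutativity and the classical limit\<close>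

lemma homogeneous_h_coeff:
  assumes "A \<in> homogeneous_h scale a"
  shows "2 * i \<le> a \<Longrightarrow> of_degree (a - 2 * i) (coeff A i)" "\<not> 2 * i \<le> a \<Longrightarrow> coeff A i = 0"
proof -
  have *: "coeff A i vs = 0" if "length vs + 2 * i \<noteq> a" for vs
  proof -
    have "component (length vs) (coeff A i) = 0" using assms that by (auto simp: homogeneous_h_def)
    then have "component (length vs) (coeff A i) vs = 0" by (simp add: form_apply)
    then show ?thesis by (simp add: component_def)
  qed
  show "of_degree (a - 2 * i) (coeff A i)" if "2 * i \<le> a"
    using * that by (auto simp: of_degree_def)
  show "coeff A i = 0" if "\<not> 2 * i \<le> a"
    using * that by (auto simp: fun_eq_iff form_apply)
qed

text \<open>Since \<open>h\<close> has even degree, the coefficients have form degrees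
  \<open>a - 2 * i\<close> and \<open>b - 2 * j\<close> of the same parity as \<open>a\<close> and
  \<open>b\<close>; the sign is therefore the same for all coefficients.\<close>

lemma qh_commute:
  assumes A: "A \<in> homogeneous_h scale a" and C: "C \<in> homogeneous_h scale b"
  shows "qh A C = scale_h ((-1) ^ (a * b)) (qh C A)"
proof -
  have ext: "A \<in> ext_alg_h scale" "C \<in> ext_alg_h scale" using A C by (auto simp: homogeneous_h_def)
  then have ext': "coeff A i \<in> ext_alg scale" "coeff C i \<in> ext_alg scale" for i by (auto simp: ext_alg_h_def)
  have t: "qterm N i j (coeff A i) (coeff C j) = (-1) ^ (a * b) *\<^sub>f qterm N j i (coeff C j) (coeff A i)" for N i j
  proof (cases "2 * i \<le> a \<and> 2 * j \<le> b")
    case True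
    then have "even ((a - 2 * i) * (b - 2 * j)) \<longleftrightarrow> even (a * b)" by simp
    then have "(-1) ^ ((a - 2 * i) * (b - 2 * j)) = ((-1) ^ (a * b) :: 'k)"
      by (simp only: minus_one_power_iff)
    then show ?thesis
      using Q_commute[OF ext_algD(2)[OF ext'(1)] ext_algD(2)[OF ext'(2)]
          homogeneous_h_coeff(1)[OF A] homogeneous_h_coeff(1)[OF C]] True
      by (auto simp: qterm_def add.commute)
  qed (use homogeneous_h_coeff(2)[OF A] homogeneous_h_coeff(2)[OF C] in \<open>auto simp: qterm_simps\<close>)
  \<comment> \<open>The sign is a polynomial in the statement; being constant, it acts through
    \<open>smult\<close>.\<close>
  have "(-1) ^ k = [:(-1) ^ k :: 'k:]" for k
    by (induction k) (simp_all add: one_pCons)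
  then have "scale_h ((-1) ^ (a * b)) (qh C A) = smult (\<lambda>_. (-1) ^ (a * b)) (qh C A)"
    by (simp only: scale_h_pCons scale_h_0) simp
  then show ?thesis
    by (simp only: poly_eq_iff coeff_smult_const coeff_qh[OF ext(1) order.refl order.refl]
        coeff_qh[OF ext(2) order.refl order.refl] t form.scale_sum_right)
       (intro allI sum.swap)
qed

text \<open>Only the constant coefficients and the term \<open>Q 0\<close> contribute to
  \<open>h^0\<close>.\<close>

lemma coeff_qh_0:
  assumes "A \<in> ext_alg_h scale"
  shows "coeff (qh A C) 0 = wedge (coeff A 0) (coeff C 0)"
  unfolding coeff_qh[OF assms order.refl order.refl] sum.atMost_shift
  by (simp add: qterm_Suc) (simp add: qterm_def Q_0)

end

theorem theorem1:
  fixes scale :: "'k::field_char_0 \<Rightarrow> 'v::ab_group_add \<Rightarrow> 'v"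
    and Basis :: "'v set"
    and w :: "('v \<Rightarrow> 'k) \<Rightarrow> ('v \<Rightarrow> 'k) \<Rightarrow> 'k"
  assumes "finite_dimensional_vector_space scale Basis"
    and "bivector scale w"
  shows "(\<forall>a b. \<forall>\<alpha>\<in>homogeneous_h scale a. \<forall>\<beta>\<in>homogeneous_h scale b.
            qwedge_h scale Basis w \<alpha> \<beta> =
              scale_h ((-1) ^ (a * b)) (qwedge_h scale Basis w \<beta> \<alpha>)) \<and>
         (\<forall>\<alpha>\<in>ext_alg_h scale. \<forall>\<beta>\<in>ext_alg_h scale. \<forall>\<gamma>\<in>ext_alg_h scale.
            qwedge_h scale Basis w (qwedge_h scale Basis w \<alpha> \<beta>) \<gamma> =
              qwedge_h scale Basis w \<alpha> (qwedge_h scale Basis w \<beta> \<gamma>)) \<and>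
         deformation_quantization scale (qwedge_h scale Basis w)"
proof -
  interpret bivector_space scale Basis w
    using assms by (simp add: bivector_space_def bivector_space_axioms_def)
  have "deformation_quantization scale qh"
    unfolding deformation_quantization_def
    using ext_alg_h_qh qh_add qh_scale_h ext_alg_h_scale_h qh_assoc coeff_qh_0 by simp
  then show ?thesis using qh_commute qh_assoc by blast
qed

end
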